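(* The edge labeling $\sigma$ of the covering relations of $(\Omega,\le_S)$ is an EL-labeling: for every pair $\omega<_S\omega'$ in $\Omega$, (EL1) there is a unique maximal chain $\omega=\omega_0\lessdot_S\omega_1\lessdot_S\cdots\lessdot_S\omega_k=\omega'$ whose label sequence $\sigma(\omega_0,\omega_1)\sigma(\omega_1,\omega_2)\cdots\sigma(\omega_{k-1},\omega_k)$ is weakly increasing, and (EL2) this label sequence is lexicographically smaller than the label sequence of every other maximal chain from $\omega$ to $\omega'$.
   Context: A pre-order on $[n]$ is a reflexive transitive relation $\preceq$; its blocks are the classes of $i\equiv j\iff i\preceq j\preceq i$, partially ordered by $\preceq$. Blocks $B,B'$ overlap if $[\min B,\max B]\cap[\min B',\max B']\ne\emptyset$; $B'$ covers $B$ if $B\prec B'$ with no block strictly between. $\Omega$ is the set of permutation pre-orders on $[n]$: pre-orders with (P1) overlapping blocks comparable and (P2) every cover between blocks between overlapping blocks. $\omega\le_S\omega'$ iff every relation of $\omega$ holds in $\omega'$; $\lessdot_S$ denotes covering in this poset. If $\omega\lessdot_S\omega'$, then $\omega'$ is obtained from $\omega$ by merging exactly two blocks of $\omega$ into one block (all other blocks unchanged). Placement: for $\omega\in\Omega$, let $\lambda(\omega)$ be the permutation obtained by writing each block as a decreasing sequence and concatenating these so that $B_1\prec B_2$ puts $B_2$ to the right of $B_1$, and incomparable blocks (which do not overlap) are ordered left to right by increasing value. Number the blocks $1,\ldots,|\omega|$ in their left-to-right order in $\lambda(\omega)$; this number is the placement $pl_\omega(B)$ of block $B$. The label of a cover $\omega\lessdot_S\omega'$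 is $\sigma(\omega,\omega')=\max(pl_\omega(B_1),pl_\omega(B_2))$, where $B_1,B_2$ are the two blocks of $\omega$ merged in $\omega'$. A sequence $a_1\cdots a_k$ is lexicographically smaller than $b_1\cdots b_k$ if for some $j$, $a_i=b_i$ for $i<j$ and $a_j<b_j$. *)

theory Defs
  imports Main
begin

section \<open>Blocks of a pre-order\<close>

text \<open>A pre-order on \<open>{1..n}\<close> is a relation \<open>\<omega>\<close> with \<open>preorder_on {1..n} \<omega>\<close>, where
  \<open>(i, j) \<in> \<omega>\<close> means \<open>i \<preceq> j\<close>. Since \<open>\<omega>\<close> is reflexive on \<open>{1..n}\<close>, its field is \<open>{1..n}\<close>,
  so the ground set need not be passed to the definitions below.\<close>

definition blocks :: "nat rel \<Rightarrow> nat set set" where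
  "blocks \<omega> = Field \<omega> // (\<omega> \<inter> \<omega>\<inverse>)"

text \<open>For blocks of a pre-order it does not matter which representatives are compared.\<close>

definition block_le :: "nat rel \<Rightarrow> nat set \<Rightarrow> nat set \<Rightarrow> bool" where
  "block_le \<omega> B B' \<longleftrightarrow> (\<exists>x\<in>B. \<exists>y\<in>B'. (x, y) \<in> \<omega>)"

definition block_less :: "nat rel \<Rightarrow> nat set \<Rightarrow> nat set \<Rightarrow> bool" where
  "block_less \<omega> B B' \<longleftrightarrow> block_le \<omega> B B' \<and> B \<noteq> B'"

definition block_comparable :: "nat rel \<Rightarrow> nat set \<Rightarrow> nat set \<Rightarrow> bool" where
  "block_comparable \<omega> B B' \<longleftrightarrow> block_le \<omega> B B' \<or> block_le \<omega> B' B"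

definition block_covered_by :: "nat rel \<Rightarrow> nat set \<Rightarrow> nat set \<Rightarrow> bool" where
  "block_covered_by \<omega> B B' \<longleftrightarrow>
     block_less \<omega> B B' \<and> \<not> (\<exists>C\<in>blocks \<omega>. block_less \<omega> B C \<and> block_less \<omega> C B')"

definition overlap :: "nat set \<Rightarrow> nat set \<Rightarrow> bool" where
  "overlap B B' \<longleftrightarrow> {Min B..Max B} \<inter> {Min B'..Max B'} \<noteq> {}"


section \<open>Permutation pre-orders\<close>

text \<open>The order \<open>\<le>\<^sub>S\<close> on \<open>\<Omega>\<close> is inclusion of relations.\<close>

definition perm_preorders :: "nat \<Rightarrow> nat rel set" where
  "perm_preorders n = {\<omega>. preorder_on {1..n} \<omega> \<and>
     (\<forall>B\<in>blocks \<omega>. \<forall>B'\<in>blocks \<omega>. overlap B B' \<longrightarrow> block_comparable \<omega> B B') \<and>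
     (\<forall>B\<in>blocks \<omega>. \<forall>B'\<in>blocks \<omega>. block_covered_by \<omega> B B' \<longrightarrow> overlap B B')}"


section \<open>Placement of blocks\<close>

text \<open>Incomparable blocks of a permutation pre-order do not overlap, so one of them lies
  entirely below the other and \<open>Max B < Min B'\<close> says that \<open>B\<close> is the lower one.\<close>

definition left_of :: "nat rel \<Rightarrow> nat set \<Rightarrow> nat set \<Rightarrow> bool" where
  "left_of \<omega> B B' \<longleftrightarrow>
     block_less \<omega> B B' \<or> (\<not> block_comparable \<omega> B B' \<and> Max B < Min B')"

definition block_sequence :: "nat rel \<Rightarrow> nat set list" where
  "block_sequence \<omega> =
     (THE Bs. distinct Bs \<and> set Bs = blocks \<omega> \<and> sorted_wrt (left_of \<omega>) Bs)"

text \<open>The permutation \<open>\<lambda>(\<omega>)\<close> in one-line notation. The left-to-right order in which the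
  blocks occur in it is \<open>block_sequence \<omega>\<close>, from which the placement is read off.\<close>

definition lambda_word :: "nat rel \<Rightarrow> nat list" where
  "lambda_word \<omega> = concat (map (\<lambda>B. rev (sorted_list_of_set B)) (block_sequence \<omega>))"

text \<open>Blocks are numbered from 1, list positions from 0.\<close>

definition placement :: "nat rel \<Rightarrow> nat set \<Rightarrow> nat" where
  "placement \<omega> B =
     Suc (THE i. i < length (block_sequence \<omega>) \<and> block_sequence \<omega> ! i = B)"

definition merges :: "nat rel \<Rightarrow> nat rel \<Rightarrow> nat set \<Rightarrow> nat set \<Rightarrow> bool" where
  "merges \<omega> \<omega>' B1 B2 \<longleftrightarrow> B1 \<in> blocks \<omega> \<and> B2 \<in> blocks \<omega> \<and> B1 \<noteq> B2 \<and>
     blocks \<omega>' = insert (B1 \<union> B2) (blocks \<omega> - {B1, B2})"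

text \<open>Only meaningful on covering pairs, where the merged pair is unique up to swapping.\<close>

definition cover_label :: "nat rel \<Rightarrow> nat rel \<Rightarrow> nat" where
  "cover_label \<omega> \<omega>' =
     (THE l. \<exists>B1 B2. merges \<omega> \<omega>' B1 B2 \<and> l = max (placement \<omega> B1) (placement \<omega> B2))"


section \<open>EL-labelings\<close>

definition covered_by :: "'a set \<Rightarrow> ('a \<Rightarrow> 'a \<Rightarrow> bool) \<Rightarrow> 'a \<Rightarrow> 'a \<Rightarrow> bool" where
  "covered_by P le x y \<longleftrightarrow> x \<in> P \<and> y \<in> P \<and> le x y \<and> x \<noteq> y \<and>
     \<not> (\<exists>z\<in>P. le x z \<and> z \<noteq> x \<and> le z y \<and> z \<noteq> y)"

definition maximal_chain ::
    "'a set \<Rightarrow> ('a \<Rightarrow> 'a \<Rightarrow> bool) \<Rightarrow> 'a \<Rightarrow> 'a \<Rightarrow> 'a list \<Rightarrow> bool" where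
  "maximal_chain P le x y c \<longleftrightarrow>
     c \<noteq> [] \<and> hd c = x \<and> last c = y \<and> successively (covered_by P le) c"

definition label_sequence :: "('a \<Rightarrow> 'a \<Rightarrow> nat) \<Rightarrow> 'a list \<Rightarrow> nat list" where
  "label_sequence \<sigma> c = map (\<lambda>(x, y). \<sigma> x y) (zip c (tl c))"

text \<open>\<open>lex\<close> relates only lists of equal length, so (EL2) compares \<open>a\<^sub>1\<dots>a\<^sub>k\<close> with
  \<open>b\<^sub>1\<dots>b\<^sub>k\<close> at the first index where they differ.\<close>

definition EL_labeling ::
    "'a set \<Rightarrow> ('a \<Rightarrow> 'a \<Rightarrow> bool) \<Rightarrow> ('a \<Rightarrow> 'a \<Rightarrow> nat) \<Rightarrow> bool" where
  "EL_labeling P le \<sigma> \<longleftrightarrow>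
     (\<forall>x\<in>P. \<forall>y\<in>P. le x y \<and> x \<noteq> y \<longrightarrow>
        (\<exists>!c. maximal_chain P le x y c \<and> sorted (label_sequence \<sigma> c)) \<and>
        (\<forall>c d. maximal_chain P le x y c \<and> sorted (label_sequence \<sigma> c) \<and>
               maximal_chain P le x y d \<and> d \<noteq> c \<longrightarrow>
           (label_sequence \<sigma> c, label_sequence \<sigma> d) \<in> lex less_than))"

end

theory Submission
  imports Defs
begin

text \<open>Order the elements by the position of their blocks in \<open>\<lambda>(\<omega>)\<close>. Given \<open>\<omega> <\<^sub>S \<omega>'\<close>, let \<open>B\<close>
  be the leftmost block of \<open>\<omega>\<close> that shares its block of \<open>\<omega>'\<close> with a block \<open>A\<close> further to the
  left. Exactly one atom of the interval merges these two blocks: a block that overlaps the union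
  of the two is, if it lies to the right of both, forced above them by \<open>\<omega>\<close>, and otherwise
  oriented by \<open>\<omega>'\<close>. This atom has the least label. Merging two blocks, the right one of which
  has placement \<open>l\<close>, produces an initial segment of \<open>l - 1\<close> blocks made of the same elements as
  the first \<open>l\<close> blocks before. Hence after the least atom all labels are at least as large, whereas
  after any other atom the pair \<open>A, B\<close> is still to be merged among the first \<open>l - 1\<close> blocks, which
  makes a smaller label available.\<close>

section \<open>Labelings with a least first step\<close>

lemma maximal_chain_Cons:
  "maximal_chain P le x y (x # c) \<longleftrightarrow>
     (if c = [] then x = y else covered_by P le x (hd c) \<and> maximal_chain P le (hd c) y c)"
  by (cases c) (auto simp: maximal_chain_def)

lemma label_sequence_Cons:
  "label_sequence \<sigma> (x # c) = (if c = [] then [] else \<sigma> x (hd c) # label_sequence \<sigma> c)"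
  by (cases c) (auto simp: label_sequence_def)

lemma sorted_label_sequence_Cons:
  "sorted (label_sequence \<sigma> (x # y # c)) \<longleftrightarrow>
     (c \<noteq> [] \<longrightarrow> \<sigma> x y \<le> \<sigma> y (hd c)) \<and> sorted (label_sequence \<sigma> (y # c))"
proof (cases c)
  case (Cons z c')
  have "sorted (l # m # ms) \<longleftrightarrow> l \<le> m \<and> sorted (m # ms)" for l m :: nat and ms
    by auto
  then show ?thesis by (simp add: label_sequence_Cons Cons)
qed (simp add: label_sequence_Cons)

text \<open>The rank drops by one at every cover. That all maximal chains of an interval have equal
  length makes \<open>lex\<close>, which relates only lists of equal length, applicable to their
  labels.\<close>

lemma maximal_chain_length:
  fixes r :: "'a \<Rightarrow> nat"
  assumes "\<And>x y. covered_by P le x y \<Longrightarrow> r x = Suc (r y)"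
    and "maximal_chain P le x y c"
  shows "r x + 1 = r y + length c"
  using assms(2)
proof (induction c arbitrary: x)
  case Nil
  then show ?case by (simp add: maximal_chain_def)
next
  case (Cons z c)
  then have [simp]: "z = x" by (simp add: maximal_chain_def)
  show ?case
  proof (cases "c = []")
    case False
    with Cons.prems have "covered_by P le x (hd c)" "maximal_chain P le (hd c) y c"
      by (auto simp: maximal_chain_Cons)
    with Cons.IH[of "hd c"] assms(1) show ?thesis by fastforce
  qed (use Cons.prems in \<open>auto simp: maximal_chain_Cons\<close>)
qed

lemma length_label_sequence: "length (label_sequence \<sigma> c) = length c - 1"
  by (simp add: label_sequence_def)

lemma maximal_chain_le:
  assumes trans: "\<And>x y z. le x y \<Longrightarrow> le y z \<Longrightarrow> le x z" and refl: "\<And>x. le x x"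
    and "maximal_chain P le x y c"
  shows "le x y"
  using assms(3)
proof (induction c arbitrary: x)
  case Nil
  then show ?case by (simp add: maximal_chain_def)
next
  case (Cons z c)
  then have [simp]: "z = x" by (simp add: maximal_chain_def)
  show ?case
  proof (cases "c = []")
    case False
    with Cons.prems have "covered_by P le x (hd c)" "maximal_chain P le (hd c) y c"
      by (auto simp: maximal_chain_Cons)
    with Cons.IH[of "hd c"] show ?thesis unfolding covered_by_def by (blast intro: trans)
  qed (use Cons.prems refl in \<open>auto simp: maximal_chain_Cons\<close>)
qed

lemma maximal_chain_neqE:
  assumes "maximal_chain P le x y c" "x \<noteq> y"
  obtains w d where "c = x # w # d" "covered_by P le x w" "maximal_chain P le w y (w # d)"
proof (cases c)
  case Nil
  with assms show ?thesis by (simp add: maximal_chain_def)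
next
  case (Cons x' c')
  with assms have "x' = x" by (simp add: maximal_chain_def)
  with Cons assms that show ?thesis by (cases c') (auto simp: maximal_chain_Cons)
qed

text \<open>Induction on the rank of \<open>x\<close>: the least atom \<open>z\<close> is prolonged
  by the increasing chain from \<open>z\<close> to \<open>y\<close>. For any other atom
  \<open>w\<close>, the increasing chain from \<open>w\<close> to \<open>y\<close> is
  lexicographically least, so its first label is at most the available \<open>\<sigma> w v\<close>,
  hence below \<open>\<sigma> x w\<close>, and putting \<open>x\<close> in front of it cannot give
  an increasing chain.\<close>

lemma EL_labelingI:
  fixes r :: "'a \<Rightarrow> nat" and \<sigma> :: "'a \<Rightarrow> 'a \<Rightarrow> nat"
  assumes trans: "\<And>x y z. le x y \<Longrightarrow> le y z \<Longrightarrow> le x z" and refl: "\<And>x. le x x"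
    and rank: "\<And>x y. covered_by P le x y \<Longrightarrow> r x = Suc (r y)"
    and first_step: "\<And>x y. x \<in> P \<Longrightarrow> y \<in> P \<Longrightarrow> le x y \<Longrightarrow> x \<noteq> y \<Longrightarrow>
      \<exists>z. covered_by P le x z \<and> le z y \<and>
        (\<forall>v. covered_by P le z v \<and> le v y \<longrightarrow> \<sigma> x z \<le> \<sigma> z v) \<and>
        (\<forall>w. covered_by P le x w \<and> le w y \<and> w \<noteq> z \<longrightarrow> \<sigma> x z < \<sigma> x w \<and>
          (w \<noteq> y \<longrightarrow> (\<exists>v. covered_by P le w v \<and> le v y \<and> \<sigma> w v < \<sigma> x w)))"
  shows "EL_labeling P le \<sigma>"
proof -
  have main: "\<exists>c. maximal_chain P le x y c \<and> sorted (label_sequence \<sigma> c) \<and>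
      (\<forall>d. maximal_chain P le x y d \<and> d \<noteq> c \<longrightarrow>
        \<not> sorted (label_sequence \<sigma> d) \<and> (label_sequence \<sigma> c, label_sequence \<sigma> d) \<in> lex less_than)"
    if "x \<in> P" "y \<in> P" "le x y" for x y
    using that
  proof (induction "r x" arbitrary: x rule: less_induct)
    case less
    have len: "r u + 1 = r v + length d" if "maximal_chain P le u v d" for u v d
      by (rule maximal_chain_length[OF rank that])
    have le: "le u v" if "maximal_chain P le u v d" for u v d
      by (rule maximal_chain_le[OF trans refl that])
    show ?case
    proof (cases "x = y")
      case True
      have "d = [x]" if "maximal_chain P le x y d" for d
        using len[OF that] that True by (cases d) (auto simp: maximal_chain_def)
      then show ?thesis using True
        by (intro exI[of _ "[x]"]) (auto simp: maximal_chain_def label_sequence_def)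
    next
      case False
      obtain z where z: "covered_by P le x z" "le z y"
        and z_next: "\<And>v. covered_by P le z v \<Longrightarrow> le v y \<Longrightarrow> \<sigma> x z \<le> \<sigma> z v"
        and other: "\<And>w. covered_by P le x w \<Longrightarrow> le w y \<Longrightarrow> w \<noteq> z \<Longrightarrow> \<sigma> x z < \<sigma> x w \<and>
          (w \<noteq> y \<longrightarrow> (\<exists>v. covered_by P le w v \<and> le v y \<and> \<sigma> w v < \<sigma> x w))"
        using first_step[OF less.prems False] by metis
      have step: "r w < r x" "w \<in> P" if "covered_by P le x w" for w
        using rank[OF that] that by (auto simp: covered_by_def)
      obtain c where c: "maximal_chain P le z y c" "sorted (label_sequence \<sigma> c)"
        and c_min: "\<And>d. maximal_chain P le z y d \<Longrightarrow> d \<noteq> c \<Longrightarrow>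
        \<not> sorted (label_sequence \<sigma> d) \<and> (label_sequence \<sigma> c, label_sequence \<sigma> d) \<in> lex less_than"
        using less.hyps[OF step[OF z(1)] less.prems(2) z(2)] by metis
      obtain c' where c': "c = z # c'" using c(1) by (cases c) (auto simp: maximal_chain_def)
      have 1: "maximal_chain P le x y (x # c)"
        using c(1) c' z(1) by (auto simp: maximal_chain_Cons)
      have 2: "sorted (label_sequence \<sigma> (x # c))"
      proof -
        have "\<sigma> x z \<le> \<sigma> z (hd c')" if "c' \<noteq> []"
          using c(1) c' that by (intro z_next) (auto simp: maximal_chain_Cons intro: le)
        then show ?thesis using c(2) c' by (auto simp: sorted_label_sequence_Cons)
      qed
      have 3: "\<not> sorted (label_sequence \<sigma> d) \<and>
          (label_sequence \<sigma> (x # c), label_sequence \<sigma> d) \<in> lex less_than"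
        if d: "maximal_chain P le x y d" "d \<noteq> x # c" for d
      proof -
        obtain w e where e: "d = x # w # e" "covered_by P le x w" "maximal_chain P le w y (w # e)"
          using maximal_chain_neqE[OF d(1) False] by metis
        have "length d = length (x # c)" using len[OF d(1)] len[OF 1] by simp
        then have length_eq: "length (label_sequence \<sigma> (w # e)) = length (label_sequence \<sigma> c)"
          using e(1) by (simp add: length_label_sequence)
        show ?thesis
        proof (cases "w = z")
          case True
          with e d(2) have "w # e \<noteq> c" by auto
          from c_min[OF _ this] e True c' show ?thesis
            by (auto simp: sorted_label_sequence_Cons label_sequence_Cons)
        next
          case neq: False
          have wy: "le w y" using le[OF e(3)] .
          note other_w = other[OF e(2) wy neq]
          \<comment> \<open>Otherwise the atom \<open>z\<close> would lie strictly between
            \<open>x\<close> and its cover \<open>y\<close>.\<close>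
          have "w \<noteq> y"
          proof
            assume "w = y"
            with e(2) z neq show False by (auto simp: covered_by_def)
          qed
          then obtain v where v: "covered_by P le w v" "le v y" "\<sigma> w v < \<sigma> x w"
            using other_w by blast
          have v_P: "v \<in> P" and "r v < r x"
            using v(1) rank[OF v(1)] step[OF e(2)] by (auto simp: covered_by_def)
          from less.hyps[OF \<open>r v < r x\<close> v_P less.prems(2) v(2)]
          obtain f where f: "maximal_chain P le v y f" by blast
          then obtain f' where f': "f = v # f'" by (cases f) (auto simp: maximal_chain_def)
          have wf: "maximal_chain P le w y (w # f)"
            using f f' v(1) by (auto simp: maximal_chain_Cons)
          have "\<not> sorted (label_sequence \<sigma> d)"
          proof
            assume "sorted (label_sequence \<sigma> d)"
            moreover obtain u g where g: "w # e = w # u # g"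
              using maximal_chain_neqE[OF e(3) \<open>w \<noteq> y\<close>] by metis
            ultimately have s: "sorted (label_sequence \<sigma> (w # e))" "\<sigma> x w \<le> \<sigma> w u"
              using e(1) by (auto simp: sorted_label_sequence_Cons)
            \<comment> \<open>The increasing tail is the chain singled out by the induction
              hypothesis at \<open>w\<close>, so its first label cannot exceed that of the chain
              through \<open>v\<close>.\<close>
            have "w # f = w # e \<or>
                (label_sequence \<sigma> (w # e), label_sequence \<sigma> (w # f)) \<in> lex less_than"
              using less.hyps[OF step[OF e(2)] less.prems(2) wy] e(3) s(1) wf by metis
            then have "\<sigma> w u \<le> \<sigma> w v" using g f' by (auto simp: label_sequence_Cons)
            with s(2) v(3) show False by simp
          qed
          moreover have "(label_sequence \<sigma> (x # c), label_sequence \<sigma> d) \<in> lex less_than"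
            using other_w length_eq e(1) c' by (simp add: label_sequence_Cons split: if_splits)
          ultimately show ?thesis by blast
        qed
      qed
      from 1 2 3 show ?thesis by (intro exI[of _ "x # c"]) blast
    qed
  qed
  show ?thesis
    unfolding EL_labeling_def
  proof (intro ballI impI)
    fix x y
    assume "x \<in> P" "y \<in> P" "le x y \<and> x \<noteq> y"
    then obtain c where c: "maximal_chain P le x y c" "sorted (label_sequence \<sigma> c)"
      and other: "\<And>d. maximal_chain P le x y d \<Longrightarrow> d \<noteq> c \<Longrightarrow>
        \<not> sorted (label_sequence \<sigma> d) \<and> (label_sequence \<sigma> c, label_sequence \<sigma> d) \<in> lex less_than"
      using main[of x y] by blast
    then have unique: "d = c" if "maximal_chain P le x y d" "sorted (label_sequence \<sigma> d)" for d
      using that by blast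
    show "(\<exists>!c. maximal_chain P le x y c \<and> sorted (label_sequence \<sigma> c)) \<and>
        (\<forall>c d. maximal_chain P le x y c \<and> sorted (label_sequence \<sigma> c) \<and>
               maximal_chain P le x y d \<and> d \<noteq> c \<longrightarrow>
           (label_sequence \<sigma> c, label_sequence \<sigma> d) \<in> lex less_than)"
      using c other unique by blast
  qed
qed

section \<open>Permutation pre-orders in terms of elements\<close>

definition cls :: "nat rel \<Rightarrow> nat \<Rightarrow> nat set" where
  "cls \<omega> x = {y. (x, y) \<in> \<omega> \<and> (y, x) \<in> \<omega>}"

text \<open>For finite nonempty sets this is \<open>Min A \<le> Max B\<close> and
  \<open>Min B \<le> Max A\<close>, that is, \<open>overlap\<close>. The quantified form is visibly
  monotone in both sets.\<close>

definition meets :: "nat set \<Rightarrow> nat set \<Rightarrow> bool" where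
  "meets A B \<longleftrightarrow> (\<exists>p\<in>A. \<exists>q\<in>B. p \<le> q) \<and> (\<exists>p\<in>A. \<exists>q\<in>B. q \<le> p)"

definition local_rel :: "nat rel \<Rightarrow> nat rel" where
  "local_rel \<omega> = {(x, y) \<in> \<omega>. meets (cls \<omega> x) (cls \<omega> y)}"

text \<open>The order of positions in \<open>\<lambda>(\<omega>)\<close>, up to the order within a block: incomparable blocks do not
  overlap, so any two of their elements decide which block is the lower one.\<close>
definition weakly_left :: "nat rel \<Rightarrow> nat \<Rightarrow> nat \<Rightarrow> bool" where
  "weakly_left \<omega> x y \<longleftrightarrow> (x, y) \<in> \<omega> \<or> (y, x) \<notin> \<omega> \<and> x < y"

lemma meets_sym: "meets A B \<longleftrightarrow> meets B A"
  by (auto simp: meets_def)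

lemma meets_mono: "meets A B \<Longrightarrow> A \<subseteq> A' \<Longrightarrow> B \<subseteq> B' \<Longrightarrow> meets A' B'"
  unfolding meets_def by blast

lemma meets_common: "x \<in> A \<Longrightarrow> x \<in> B \<Longrightarrow> meets A B"
  unfolding meets_def by blast

lemma local_rel_subset: "local_rel \<omega> \<subseteq> \<omega>"
  by (auto simp: local_rel_def)

text \<open>\<open>generated\<close> stands for (P2). Unlike a condition on covers, it can be
  checked directly for a relation obtained by adding pairs, because each new pair only has to be
  factored into local steps.\<close>

locale perm_preorder =
  fixes n :: nat and \<omega> :: "nat rel"
  assumes preorder: "preorder_on {1..n} \<omega>"
    and comparable: "x \<in> {1..n} \<Longrightarrow> y \<in> {1..n} \<Longrightarrow> meets (cls \<omega> x) (cls \<omega> y) \<Longrightarrow>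
      (x, y) \<in> \<omega> \<or> (y, x) \<in> \<omega>"
    and generated: "\<omega> \<subseteq> (local_rel \<omega>)\<^sup>+"
begin

abbreviation wl where "wl \<equiv> weakly_left \<omega>"

lemma refl: "x \<in> {1..n} \<Longrightarrow> (x, x) \<in> \<omega>"
  using preorder by (auto simp: preorder_on_def refl_on_def)

lemma trans: "(x, y) \<in> \<omega> \<Longrightarrow> (y, z) \<in> \<omega> \<Longrightarrow> (x, z) \<in> \<omega>"
  using preorder unfolding preorder_on_def trans_def by blast

lemma dom: "(x, y) \<in> \<omega> \<Longrightarrow> x \<in> {1..n}" "(x, y) \<in> \<omega> \<Longrightarrow> y \<in> {1..n}"
  using preorder unfolding preorder_on_def by blast+

lemma in_cls_self: "x \<in> {1..n} \<Longrightarrow> x \<in> cls \<omega> x"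
  by (simp add: cls_def refl)

lemma cls_eq_iff: "x \<in> {1..n} \<Longrightarrow> cls \<omega> x = cls \<omega> y \<longleftrightarrow> (x, y) \<in> \<omega> \<and> (y, x) \<in> \<omega>"
  unfolding cls_def using refl trans by blast

lemma cls_subset: "cls \<omega> x \<subseteq> {1..n}"
  unfolding cls_def using dom by blast

lemma cls_eqI: "y \<in> cls \<omega> x \<Longrightarrow> cls \<omega> y = cls \<omega> x"
  unfolding cls_def using trans by blast

text \<open>By \<open>generated\<close> there is a path of local steps from \<open>x\<close> to
  \<open>y\<close>; it must leave \<open>W\<close> somewhere, and the step at which it does connects
  overlapping classes.\<close>

lemma local_exit:
  assumes "(x, y) \<in> \<omega>" "x \<in> W" "y \<notin> W"
  obtains u v where "(x, u) \<in> \<omega>" "(u, v) \<in> \<omega>" "(v, y) \<in> \<omega>" "u \<in> W" "v \<notin> W"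
    "meets (cls \<omega> u) (cls \<omega> v)"
proof -
  have "(x, y) \<in> (local_rel \<omega>)\<^sup>+" using assms(1) generated by blast
  then have "(x, y) \<in> \<omega> \<and> (y \<notin> W \<longrightarrow>
      (\<exists>u v. (x, u) \<in> \<omega> \<and> (u, v) \<in> local_rel \<omega> \<and> (v, y) \<in> \<omega> \<and> u \<in> W \<and> v \<notin> W))"
  proof induction
    case (base y)
    then have "(x, y) \<in> \<omega>" using local_rel_subset by blast
    then show ?case using base assms(2) refl dom by blast
  next
    case (step y z)
    then have "(y, z) \<in> \<omega>" "(x, y) \<in> \<omega>" using local_rel_subset by auto
    then show ?case using step refl dom trans by blast
  qed
  then show thesis using that assms(3) by (auto simp: local_rel_def)
qed

text \<open>A path of local steps between values on the two sides of \<open>z\<close> passes through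
  a class with elements weakly on both sides of \<open>z\<close>. That class overlaps the class of
  \<open>z\<close> and is therefore comparable with it.\<close>

lemma crossing:
  assumes xy: "(x, y) \<in> \<omega>" and z: "x \<le> z \<and> z \<le> y \<or> y \<le> z \<and> z \<le> x"
  shows "(x, z) \<in> \<omega> \<or> (z, y) \<in> \<omega>"
proof -
  have zn: "z \<in> {1..n}" using z dom[OF xy] by auto
  have hit: "(x, z) \<in> \<omega> \<or> (z, y) \<in> \<omega>"
    if v: "(x, v) \<in> \<omega>" "(v, y) \<in> \<omega>" "p \<in> cls \<omega> v" "p \<le> z" "q \<in> cls \<omega> v" "z \<le> q" for v p q
  proof -
    have "meets (cls \<omega> v) (cls \<omega> z)" using v in_cls_self[OF zn] unfolding meets_def by blast
    then show ?thesis using comparable[of v z] zn v dom trans by blast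
  qed
  have self: "x \<in> cls \<omega> x" "y \<in> cls \<omega> y" using in_cls_self dom[OF xy] by auto
  from z show ?thesis
  proof
    assume z: "x \<le> z \<and> z \<le> y"
    \<comment> \<open>The classes entirely below \<open>z\<close>. The class reached on leaving
      \<open>?W\<close> overlaps one of them and has an element at or above \<open>z\<close>, so it
      straddles \<open>z\<close>; if \<open>x\<close> is outside \<open>?W\<close>, its own class
      does.\<close>
    let ?W = "{v. \<forall>p\<in>cls \<omega> v. p < z}"
    show ?thesis
    proof (cases "x \<in> ?W")
      case True
      have "y \<notin> ?W" using self z by force
      then obtain u v where uv: "(x, u) \<in> \<omega>" "(u, v) \<in> \<omega>" "(v, y) \<in> \<omega>" "u \<in> ?W" "v \<notin> ?W"
        "meets (cls \<omega> u) (cls \<omega> v)"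
        by (rule local_exit[OF xy True])
      obtain p where "p \<in> cls \<omega> v" "z \<le> p" using uv(5) by (auto simp: not_less)
      moreover obtain q where "q \<in> cls \<omega> v" "q \<le> z"
        using uv(4,6) unfolding meets_def by force
      ultimately show ?thesis using hit[of v q p] trans[OF uv(1,2)] uv(3) by blast
    next
      case False
      then obtain p where "p \<in> cls \<omega> x" "z \<le> p" by (auto simp: not_less)
      then show ?thesis using hit[of x x p] z self(1) xy refl[OF dom(1)[OF xy]] by blast
    qed
  next
    assume z: "y \<le> z \<and> z \<le> x"
    let ?W = "{v. \<forall>p\<in>cls \<omega> v. z < p}"
    show ?thesis
    proof (cases "x \<in> ?W")
      case True
      have "y \<notin> ?W" using self z by force
      then obtain u v where uv: "(x, u) \<in> \<omega>" "(u, v) \<in> \<omega>" "(v, y) \<in> \<omega>" "u \<in> ?W" "v \<notin> ?W"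
        "meets (cls \<omega> u) (cls \<omega> v)"
        by (rule local_exit[OF xy True])
      obtain p where "p \<in> cls \<omega> v" "p \<le> z" using uv(5) by (auto simp: not_less)
      moreover obtain q where "q \<in> cls \<omega> v" "z \<le> q"
        using uv(4,6) unfolding meets_def by force
      ultimately show ?thesis using hit[of v p q] trans[OF uv(1,2)] uv(3) by blast
    next
      case False
      then obtain p where "p \<in> cls \<omega> x" "p \<le> z" by (auto simp: not_less)
      then show ?thesis using hit[of x p x] z self(1) xy refl[OF dom(1)[OF xy]] by blast
    qed
  qed
qed

section \<open>The left-to-right order of elements as a total pre-order\<close>

lemma wl_refl: "x \<in> {1..n} \<Longrightarrow> wl x x"
  by (simp add: weakly_left_def refl)

lemma wl_total: "x \<in> {1..n} \<Longrightarrow> wl x y \<or> wl y x"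
  using refl by (cases x y rule: linorder_cases) (auto simp: weakly_left_def)

lemma wl_antisym: "wl x y \<Longrightarrow> wl y x \<Longrightarrow> (x, y) \<in> \<omega> \<and> (y, x) \<in> \<omega>"
  by (auto simp: weakly_left_def)

text \<open>Where a relation is combined with a comparison of values, either \<open>x < z\<close> or
  one value lies between the two related ones, and \<open>crossing\<close> applies. For two
  comparisons of values, \<open>crossing\<close> excludes a relation from \<open>z\<close> back to
  \<open>x\<close>.\<close>

lemma wl_trans:
  assumes "wl x y" "wl y z"
  shows "wl x z"
proof -
  consider "(x, y) \<in> \<omega>" "(y, z) \<in> \<omega>"
    | "(x, y) \<in> \<omega>" "(z, y) \<notin> \<omega>" "y < z"
    | "(y, x) \<notin> \<omega>" "x < y" "(y, z) \<in> \<omega>"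
    | "(y, x) \<notin> \<omega>" "x < y" "(z, y) \<notin> \<omega>" "y < z"
    using assms by (auto simp: weakly_left_def)
  then show ?thesis
  proof cases
    case 1
    then show ?thesis using trans by (auto simp: weakly_left_def)
  next
    case 2
    then have "(z, x) \<notin> \<omega>" using trans by blast
    then show ?thesis using crossing[OF 2(1), of z] 2 by (auto simp: weakly_left_def)
  next
    case 3
    then have "(z, x) \<notin> \<omega>" using trans by blast
    then show ?thesis using crossing[OF 3(3), of x] 3 by (auto simp: weakly_left_def)
  next
    case 4
    then have "(z, x) \<notin> \<omega>" using crossing[of z x y] by auto
    then show ?thesis using 4 by (auto simp: weakly_left_def)
  qed
qed

lemma wl_rel: "(x, y) \<in> \<omega> \<Longrightarrow> wl x y"
  by (simp add: weakly_left_def)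

text \<open>Both hypotheses on \<open>x\<close> and \<open>y\<close> pass to all representatives of
  their classes, and \<open>weakly_left\<close> compares unrelated elements by value.\<close>

lemma less_of_incomparable:
  assumes "p \<in> cls \<omega> x" "q \<in> cls \<omega> y" "wl x y" "(x, y) \<notin> \<omega>"
  shows "p < q"
proof -
  have "wl p q"
    using assms wl_rel wl_trans unfolding cls_def by blast
  moreover have "(p, q) \<notin> \<omega>" using assms trans unfolding cls_def by blast
  ultimately show ?thesis by (simp add: weakly_left_def)
qed

text \<open>If \<open>e\<close> were incomparable with both \<open>a\<close> and \<open>b\<close>, its class would lie entirely above both of
  their classes.\<close>
lemma comparable_right_of_pair:
  assumes "wl a e" "wl b e" "meets (cls \<omega> a \<union> cls \<omega> b) (cls \<omega> e)"
  shows "(a, e) \<in> \<omega> \<or> (b, e) \<in> \<omega>"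
proof -
  obtain p q where "p \<in> cls \<omega> a \<union> cls \<omega> b" "q \<in> cls \<omega> e" "q \<le> p"
    using assms(3) unfolding meets_def by blast
  then show ?thesis using less_of_incomparable[of p _ q e] assms(1,2) by (metis Un_iff leD)
qed

end

section \<open>Joining two classes\<close>

text \<open>The placement of the class of \<open>x\<close>, obtained by counting instead of from the
  list \<open>block_sequence\<close>; \<open>placement_cls\<close> identifies the two.\<close>

definition pl :: "nat \<Rightarrow> nat rel \<Rightarrow> nat \<Rightarrow> nat" where
  "pl n \<omega> x = card (cls \<omega> ` {z \<in> {1..n}. weakly_left \<omega> z x})"

text \<open>Only the partitions are compared; the order between the classes of
  \<open>\<omega>'\<close> is left open. The asymmetry fixes \<open>b\<close> as the right-hand
  class, so that the label is \<open>pl n \<omega> b\<close>.\<close>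

definition joins :: "nat \<Rightarrow> nat rel \<Rightarrow> nat rel \<Rightarrow> nat \<Rightarrow> nat \<Rightarrow> bool" where
  "joins n \<omega> \<omega>' a b \<longleftrightarrow> a \<in> {1..n} \<and> b \<in> {1..n} \<and> \<not> weakly_left \<omega> b a \<and>
     (\<forall>x\<in>{1..n}. cls \<omega>' x = (if x \<in> cls \<omega> a \<union> cls \<omega> b then cls \<omega> a \<union> cls \<omega> b else cls \<omega> x))"

text \<open>The only candidates for the right-hand element of an atom below
  \<open>\<omega>'\<close>; see \<open>joins_collision\<close>.\<close>

definition collisions :: "nat \<Rightarrow> nat rel \<Rightarrow> nat rel \<Rightarrow> nat set" where
  "collisions n \<omega> \<omega>' =
     {y \<in> {1..n}. \<exists>x\<in>{1..n}. \<not> weakly_left \<omega> y x \<and> cls \<omega>' x = cls \<omega>' y}"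

definition first_collision :: "nat \<Rightarrow> nat rel \<Rightarrow> nat rel \<Rightarrow> nat \<Rightarrow> bool" where
  "first_collision n \<omega> \<omega>' b \<longleftrightarrow>
     b \<in> collisions n \<omega> \<omega>' \<and> (\<forall>y\<in>collisions n \<omega> \<omega>'. weakly_left \<omega> b y)"

context perm_preorder
begin

lemma pl_mono: "wl x y \<Longrightarrow> pl n \<omega> x \<le> pl n \<omega> y"
  unfolding pl_def by (intro card_mono) (auto intro: wl_trans)

lemma pl_less:
  assumes "y \<in> {1..n}" "\<not> wl y x"
  shows "pl n \<omega> x < pl n \<omega> y"
  unfolding pl_def
proof (rule psubset_card_mono)
  have "wl x y" using assms wl_total by blast
  have "cls \<omega> y \<notin> cls \<omega> ` {z \<in> {1..n}. wl z x}"
    using assms cls_eq_iff[of y] wl_rel wl_trans by blast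
  moreover have "cls \<omega> y \<in> cls \<omega> ` {z \<in> {1..n}. wl z y}"
    using assms wl_refl by blast
  moreover have "cls \<omega> ` {z \<in> {1..n}. wl z x} \<subseteq> cls \<omega> ` {z \<in> {1..n}. wl z y}"
    using \<open>wl x y\<close> wl_trans by blast
  ultimately show "cls \<omega> ` {z \<in> {1..n}. wl z x} \<subset> cls \<omega> ` {z \<in> {1..n}. wl z y}"
    by blast
qed simp

lemma pl_le_iff: "x \<in> {1..n} \<Longrightarrow> pl n \<omega> x \<le> pl n \<omega> y \<longleftrightarrow> wl x y"
  using pl_mono pl_less by (meson linorder_not_less)

end

locale perm_extension = perm_preorder n \<omega> + up: perm_preorder n \<omega>' for n \<omega> \<omega>' +
  assumes extends: "\<omega> \<subseteq> \<omega>'"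
begin

lemma cls_mono: "cls \<omega> x \<subseteq> cls \<omega>' x"
  using extends by (auto simp: cls_def)

lemma cls_eq_mono: "x \<in> {1..n} \<Longrightarrow> cls \<omega> x = cls \<omega> y \<Longrightarrow> cls \<omega>' x = cls \<omega>' y"
  using extends by (auto simp: cls_eq_iff up.cls_eq_iff)

text \<open>Without collisions both relations have the same classes. Comparability in
  \<open>\<omega>\<close> then forces every local pair of \<open>\<omega>'\<close> into
  \<open>\<omega>\<close>, and these pairs generate \<open>\<omega>'\<close>.\<close>

lemma collisions_nonempty:
  assumes "\<omega> \<noteq> \<omega>'"
  shows "collisions n \<omega> \<omega>' \<noteq> {}"
proof
  assume empty: "collisions n \<omega> \<omega>' = {}"
  have cls_eq: "cls \<omega> x = cls \<omega> y" if "(x, y) \<in> \<omega>'" "(y, x) \<in> \<omega>'" for x y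
  proof -
    have "x \<in> {1..n}" "y \<in> {1..n}" "cls \<omega>' x = cls \<omega>' y"
      using that up.dom[of x y] up.cls_eq_iff[of x y] by auto
    then have "wl x y" "wl y x" using empty unfolding collisions_def by blast+
    then show ?thesis using wl_antisym cls_eq_iff \<open>x \<in> {1..n}\<close> by blast
  qed
  have same: "cls \<omega>' x = cls \<omega> x" if "x \<in> {1..n}" for x
  proof
    show "cls \<omega>' x \<subseteq> cls \<omega> x"
    proof
      fix y assume "y \<in> cls \<omega>' x"
      then have "cls \<omega> x = cls \<omega> y" "y \<in> {1..n}" using cls_eq up.dom by (auto simp: cls_def)
      then show "y \<in> cls \<omega> x" using in_cls_self by simp
    qed
  qed (rule cls_mono)
  have "local_rel \<omega>' \<subseteq> \<omega>"
  proof
    fix p assume "p \<in> local_rel \<omega>'"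
    then obtain x y where p: "p = (x, y)" "(x, y) \<in> \<omega>'" "meets (cls \<omega>' x) (cls \<omega>' y)"
      by (auto simp: local_rel_def)
    have n: "x \<in> {1..n}" "y \<in> {1..n}" using up.dom[OF p(2)] by auto
    then have "(x, y) \<in> \<omega> \<or> (y, x) \<in> \<omega>" using comparable p(3) same by simp
    then show "p \<in> \<omega>" using cls_eq[of x y] p(1,2) extends cls_eq_iff[OF n(1)] by blast
  qed
  then have "(local_rel \<omega>')\<^sup>+ \<subseteq> \<omega>\<^sup>+" by (rule trancl_mono_subset)
  also have "\<omega>\<^sup>+ = \<omega>"
    by (rule trancl_id) (auto simp: trans_def intro: trans)
  finally show False using up.generated extends assms by blast
qed

lemma ex_first_collision:
  assumes "\<omega> \<noteq> \<omega>'"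
  obtains b where "first_collision n \<omega> \<omega>' b"
proof -
  obtain b where "b \<in> collisions n \<omega> \<omega>'" "\<And>y. y \<in> collisions n \<omega> \<omega>' \<Longrightarrow> pl n \<omega> b \<le> pl n \<omega> y"
    using collisions_nonempty[OF assms]
      ex_has_least_nat[of "\<lambda>y. y \<in> collisions n \<omega> \<omega>'" _ "pl n \<omega>"] by blast
  then show thesis using that pl_le_iff[of b] unfolding first_collision_def collisions_def by blast
qed

text \<open>Otherwise the right-hand one of \<open>x\<close> and \<open>y\<close> would be a
  collision strictly to the left of \<open>b\<close>.\<close>

lemma cls_eq_before_first_collision:
  assumes "first_collision n \<omega> \<omega>' b" "x \<in> {1..n}" "y \<in> {1..n}" "\<not> wl b x" "\<not> wl b y"
    and "cls \<omega>' x = cls \<omega>' y"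
  shows "cls \<omega> x = cls \<omega> y"
proof -
  have "x \<notin> collisions n \<omega> \<omega>'" "y \<notin> collisions n \<omega> \<omega>'"
    using assms(1,4,5) by (auto simp: first_collision_def)
  then have "wl x y" "wl y x" using assms(2,3,6) unfolding collisions_def by auto
  then show ?thesis using wl_antisym cls_eq_iff assms(2) by blast
qed

text \<open>Strictly left of \<open>b\<close>, minimality identifies the class of \<open>x\<close>
  with that of \<open>a\<close>. Hence the class to be joined with that of \<open>b\<close> is
  determined.\<close>

lemma first_collision_partner:
  assumes b: "first_collision n \<omega> \<omega>' b" and a: "a \<in> {1..n}" "\<not> wl b a" "cls \<omega>' a = cls \<omega>' b"
    and x: "wl x b" "x \<in> {1..n}" "cls \<omega>' x = cls \<omega>' b"
  shows "x \<in> cls \<omega> a \<union> cls \<omega> b"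
proof (cases "wl b x")
  case True
  then show ?thesis using wl_antisym x by (auto simp: cls_def)
next
  case False
  then have "cls \<omega> x = cls \<omega> a" using cls_eq_before_first_collision[OF b] a x by metis
  then show ?thesis using in_cls_self x by blast
qed

text \<open>\<open>comparable_right_of_pair\<close> relates \<open>a\<close> or \<open>b\<close> to
  \<open>e\<close> already in \<open>\<omega>\<close>, and in \<open>\<omega>'\<close> both are
  equivalent to \<open>x\<close>.\<close>

lemma joins_right_of_pair:
  assumes j: "joins n \<omega> \<omega>' a b" and e: "e \<in> {1..n}" "\<not> wl e b" "meets (cls \<omega>' b) (cls \<omega> e)"
    and x: "x \<in> cls \<omega>' b"
  shows "(x, e) \<in> \<omega>'"
proof -
  have ab: "a \<in> {1..n}" "b \<in> {1..n}" "\<not> wl b a" and M: "cls \<omega>' b = cls \<omega> a \<union> cls \<omega> b"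
    using j in_cls_self[of b] by (auto simp: joins_def)
  have "wl b e" "wl a e" using ab e wl_total[of b e] wl_total[of a b] wl_trans by blast+
  then have "(a, e) \<in> \<omega> \<or> (b, e) \<in> \<omega>" using comparable_right_of_pair e(3) M by simp
  then obtain c where "c \<in> cls \<omega>' b" "(c, e) \<in> \<omega>'" using M in_cls_self ab extends by blast
  then show ?thesis using x up.trans unfolding cls_def by blast
qed

text \<open>The elements up to \<open>b\<close> remain an initial segment: a relation of
  \<open>\<omega>'\<close> leading back across \<open>b\<close> would contain a local step across
  \<open>b\<close>, and overlapping classes on the two sides of \<open>b\<close> keep their
  left-to-right orientation.\<close>

lemma joins_initial:
  assumes j: "joins n \<omega> \<omega>' a b" and x: "wl x b" "x \<in> {1..n}" and y: "\<not> wl y b" "y \<in> {1..n}"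
  shows "\<not> weakly_left \<omega>' y x"
proof
  assume yx: "weakly_left \<omega>' y x"
  \<comment> \<open>Otherwise \<open>y\<close> precedes \<open>x\<close> in \<open>\<omega>'\<close>
    by value alone, so \<open>\<omega>\<close> leaves the two unrelated as well, whereas
    \<open>wl x y\<close> then demands \<open>x < y\<close>.\<close>
  have "(y, x) \<in> \<omega>'"
  proof (rule ccontr)
    assume "(y, x) \<notin> \<omega>'"
    moreover have "wl x y" using x y wl_total wl_trans by blast
    ultimately show False using yx extends by (auto simp: weakly_left_def)
  qed
  then obtain u v where uv: "(u, v) \<in> \<omega>'" "\<not> wl u b" "wl v b" "meets (cls \<omega>' u) (cls \<omega>' v)"
    by (rule up.local_exit[of y x "{v. \<not> wl v b}"]) (use x y in auto)
  have ab: "a \<in> {1..n}" "b \<in> {1..n}" "\<not> wl b a" and M: "cls \<omega>' b = cls \<omega> a \<union> cls \<omega> b"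
    and cls': "\<And>x. x \<in> {1..n} \<Longrightarrow> cls \<omega>' x = (if x \<in> cls \<omega>' b then cls \<omega>' b else cls \<omega> x)"
    using j in_cls_self[of b] by (auto simp: joins_def)
  have n: "u \<in> {1..n}" "v \<in> {1..n}" using up.dom[OF uv(1)] by auto
  have W: "wl z b" if "z \<in> cls \<omega>' b" for z
    using that M wl_rel wl_trans ab wl_total[of a b] unfolding cls_def by blast
  have "u \<notin> cls \<omega>' b" using uv W by blast
  then have u: "cls \<omega>' u = cls \<omega> u" using cls'[OF n(1)] by simp
  \<comment> \<open>The reverse relation makes \<open>u\<close> and \<open>v\<close> equivalent in
    \<open>\<omega>'\<close>. As the class of \<open>u\<close> is unchanged, they would then share a
    class of \<open>\<omega>\<close> although they lie on different sides of
    \<open>b\<close>.\<close>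
  have "(v, u) \<in> \<omega>'"
  proof (cases "v \<in> cls \<omega>' b")
    case True
    have "meets (cls \<omega>' b) (cls \<omega> u)" using True uv(4) u cls'[OF n(2)] by (simp add: meets_sym)
    then show ?thesis using joins_right_of_pair[OF j n(1) uv(2) _ True] by blast
  next
    case False
    then have "meets (cls \<omega> u) (cls \<omega> v)" using cls'[OF n(2)] uv(4) u by simp
    then have "(u, v) \<in> \<omega> \<or> (v, u) \<in> \<omega>" using comparable n by blast
    then show ?thesis using uv(2,3) wl_rel wl_trans extends by blast
  qed
  then have "v \<in> cls \<omega> u" using uv(1) u by (auto simp: cls_def)
  then show False using uv(2,3) wl_rel wl_trans unfolding cls_def by blast
qed

text \<open>Applied with all of \<open>{1..n}\<close> it counts blocks, and with the elements up to
  \<open>b\<close> it gives the shift of placements.\<close>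

lemma joins_image:
  assumes j: "joins n \<omega> \<omega>' a b" and W: "W \<subseteq> {1..n}" "a \<in> W" "b \<in> W"
  shows "cls \<omega>' ` W = insert (cls \<omega> a \<union> cls \<omega> b) (cls \<omega> ` W - {cls \<omega> a, cls \<omega> b})"
    and "card (cls \<omega> ` W) = Suc (card (cls \<omega>' ` W))"
proof -
  let ?M = "cls \<omega> a \<union> cls \<omega> b"
  have ab: "a \<in> {1..n}" "b \<in> {1..n}" "\<not> wl b a"
    and cls': "\<And>x. x \<in> {1..n} \<Longrightarrow> cls \<omega>' x = (if x \<in> ?M then ?M else cls \<omega> x)"
    using j by (auto simp: joins_def)
  have in_M: "z \<in> ?M \<longleftrightarrow> cls \<omega> z = cls \<omega> a \<or> cls \<omega> z = cls \<omega> b" if "z \<in> {1..n}" for z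
    using that cls_eqI in_cls_self by blast
  have ne: "cls \<omega> a \<noteq> cls \<omega> b" using ab cls_eq_iff[of a b] wl_rel by blast
  show image: "cls \<omega>' ` W = insert ?M (cls \<omega> ` W - {cls \<omega> a, cls \<omega> b})"
  proof (intro equalityI subsetI)
    fix C assume "C \<in> cls \<omega>' ` W"
    then obtain z where z: "z \<in> W" "C = cls \<omega>' z" by blast
    then have "z \<in> {1..n}" using W(1) by blast
    then show "C \<in> insert ?M (cls \<omega> ` W - {cls \<omega> a, cls \<omega> b})"
      using cls'[of z] in_M[of z] z by (simp split: if_splits)
  next
    fix C assume "C \<in> insert ?M (cls \<omega> ` W - {cls \<omega> a, cls \<omega> b})"
    then show "C \<in> cls \<omega>' ` W"
    proof
      assume "C = ?M"
      then have "C = cls \<omega>' b" using cls'[OF ab(2)] in_M[OF ab(2)] by simp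
      then show ?thesis using W(3) by blast
    next
      assume C: "C \<in> cls \<omega> ` W - {cls \<omega> a, cls \<omega> b}"
      then obtain z where z: "z \<in> W" "C = cls \<omega> z" by blast
      then have "C = cls \<omega>' z" using cls'[of z] in_M[of z] C W(1) by auto
      then show ?thesis using z(1) by blast
    qed
  qed
  have fin: "finite W" using W(1) finite_subset by blast
  have new: "?M \<notin> cls \<omega> ` W"
  proof
    assume "?M \<in> cls \<omega> ` W"
    then obtain z where "?M = cls \<omega> z" by blast
    then have "cls \<omega> a = cls \<omega> z" "cls \<omega> b = cls \<omega> z"
      using cls_eqI in_cls_self[OF ab(1)] in_cls_self[OF ab(2)] by blast+
    then show False using ne by simp
  qed
  have "card (cls \<omega> ` W - {cls \<omega> a, cls \<omega> b}) = card (cls \<omega> ` W) - 2"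
    using W ne by (subst card_Diff_subset) auto
  \<comment> \<open>There are at least two classes, so the truncated subtraction of 2 is
    exact.\<close>
  moreover have "card {cls \<omega> a, cls \<omega> b} \<le> card (cls \<omega> ` W)"
    using W fin by (intro card_mono) auto
  ultimately show "card (cls \<omega> ` W) = Suc (card (cls \<omega>' ` W))"
    using ne new fin unfolding image by (subst card_insert_disjoint) auto
qed

text \<open>The \<open>pl n \<omega> b\<close> classes up to \<open>b\<close> become one fewer by
  \<open>joins_image\<close>, and they still form an initial segment by
  \<open>joins_initial\<close>.\<close>

lemma joins_pl:
  assumes j: "joins n \<omega> \<omega>' a b" and x: "x \<in> {1..n}"
  shows "pl n \<omega>' x < pl n \<omega> b \<longleftrightarrow> wl x b"
proof -
  let ?W = "{z \<in> {1..n}. wl z b}"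
  have "a \<in> ?W" "b \<in> ?W"
    using j wl_refl wl_total[of a b] by (auto simp: joins_def)
  then have card: "Suc (card (cls \<omega>' ` ?W)) = pl n \<omega> b"
    unfolding pl_def by (intro joins_image(2)[OF j, symmetric]) auto
  show ?thesis
  proof
    assume "wl x b"
    then have "{z \<in> {1..n}. weakly_left \<omega>' z x} \<subseteq> ?W"
      using joins_initial[OF j] x by blast
    then have "pl n \<omega>' x \<le> card (cls \<omega>' ` ?W)"
      unfolding pl_def by (intro card_mono image_mono) auto
    then show "pl n \<omega>' x < pl n \<omega> b" using card by simp
  next
    assume less: "pl n \<omega>' x < pl n \<omega> b"
    show "wl x b"
    proof (rule ccontr)
      assume not: "\<not> wl x b"
      \<comment> \<open>All \<open>pl n \<omega> b - 1\<close> classes of the initial segment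
        precede \<open>x\<close>; together with the class of \<open>x\<close> itself they make its
        placement at least \<open>pl n \<omega> b\<close>.\<close>
      have left: "\<not> weakly_left \<omega>' x z" if "z \<in> ?W" for z
        using joins_initial[OF j _ _ not x] that by blast
      then have "cls \<omega>' x \<notin> cls \<omega>' ` ?W"
        using up.cls_eq_iff[OF x] up.wl_rel by blast
      then have "pl n \<omega> b = card (insert (cls \<omega>' x) (cls \<omega>' ` ?W))" using card by simp
      also have "\<dots> \<le> pl n \<omega>' x"
        unfolding pl_def using left x up.wl_total up.wl_refl by (intro card_mono) auto
      finally show False using less by simp
    qed
  qed
qed

end

section \<open>The first step of the increasing chain\<close>

context perm_extension
begin

text \<open>Existence of the least atom: \<open>\<omega>\<close> is enlarged by pairs passing
  through the united class \<open>M\<close>. Comparability has to be rechecked only near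
  \<open>M\<close>, as all other classes are unchanged.\<close>

lemma ex_join:
  assumes b: "first_collision n \<omega> \<omega>' b"
  obtains a \<omega>1 where "perm_preorder n \<omega>1" "\<omega> \<subseteq> \<omega>1" "\<omega>1 \<subseteq> \<omega>'" "joins n \<omega> \<omega>1 a b"
proof -
  obtain a where a: "a \<in> {1..n}" "\<not> wl b a" "cls \<omega>' a = cls \<omega>' b" and bn: "b \<in> {1..n}"
    using b by (auto simp: first_collision_def collisions_def)
  define M where "M = cls \<omega> a \<union> cls \<omega> b"
  define K where "K = {k \<in> {1..n}. wl k b \<and> meets M (cls \<omega> k)}"
  define I where "I = {x. \<exists>s. (x, s) \<in> \<omega> \<and> (s \<in> M \<or> s \<in> K \<and> (s, b) \<in> \<omega>')}"
  define O' where "O' = {y. \<exists>s. (s, y) \<in> \<omega> \<and> (s \<in> M \<or> s \<in> K \<and> (b, s) \<in> \<omega>')}"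
  \<comment> \<open>The classes in \<open>K\<close> may be incomparable with \<open>M\<close> in \<open>\<omega>\<close>; they take their side of \<open>M\<close> from \<open>\<omega>'\<close>.
    Since \<open>I\<close> is closed downwards and \<open>O'\<close> upwards, \<open>\<omega>1\<close> is transitive, and \<open>I \<inter> O' = M\<close> means
    that no further classes are merged.\<close>
  define \<omega>1 where "\<omega>1 = \<omega> \<union> I \<times> O'"
  have ab': "(a, b) \<in> \<omega>'" "(b, a) \<in> \<omega>'" using a up.cls_eq_iff by auto
  have M': "(x, b) \<in> \<omega>'" "(b, x) \<in> \<omega>'" if "x \<in> M" for x
    using that ab' extends up.trans unfolding M_def cls_def by blast+
  have Mn: "M \<subseteq> {1..n}" unfolding M_def using cls_subset by blast
  have abM: "a \<in> M" "b \<in> M" unfolding M_def using in_cls_self a bn by auto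
  have Mwl: "wl x b" if "x \<in> M" for x
    using that a wl_total[of a b] wl_rel wl_trans unfolding M_def cls_def by blast
  have I': "(x, b) \<in> \<omega>'" if "x \<in> I" for x
    using that M' extends up.trans unfolding I_def by blast
  have O'': "(b, x) \<in> \<omega>'" if "x \<in> O'" for x
    using that M' extends up.trans unfolding O'_def by blast
  have MIO: "M \<subseteq> I" "M \<subseteq> O'" unfolding I_def O'_def using refl Mn by blast+
  have I_down: "x \<in> I" if "(x, y) \<in> \<omega>" "y \<in> I" for x y
    using that trans unfolding I_def by blast
  have O_up: "y \<in> O'" if "(x, y) \<in> \<omega>" "x \<in> O'" for x y
    using that trans unfolding O'_def by blast
  have In: "I \<subseteq> {1..n}" "O' \<subseteq> {1..n}" unfolding I_def O'_def using dom by blast+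
  \<comment> \<open>Every intermediate \<open>s\<close> in the definition of \<open>I\<close> is at
    or left of \<open>b\<close>, and lying in both sets means being equivalent to \<open>b\<close>
    in \<open>\<omega>'\<close>; so the uniqueness of the partner applies.\<close>
  have IO: "I \<inter> O' \<subseteq> M"
  proof
    fix x assume x: "x \<in> I \<inter> O'"
    then have "wl x b" unfolding I_def K_def using Mwl wl_rel wl_trans by blast
    moreover have "x \<in> {1..n}" using In x by blast
    moreover from this have "cls \<omega>' x = cls \<omega>' b" using up.cls_eq_iff I' O'' x by blast
    ultimately show "x \<in> M" using first_collision_partner[OF b a] unfolding M_def by blast
  qed
  have sub: "\<omega> \<subseteq> \<omega>1" "\<omega>1 \<subseteq> \<omega>'"
    unfolding \<omega>1_def using extends I' O'' up.trans by blast+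
  \<comment> \<open>As \<open>I\<close> is closed downwards and \<open>O'\<close> upwards, an
    equivalence using a new pair places both elements in \<open>I \<inter> O'\<close>.\<close>
  have eqv: "(x, y) \<in> \<omega>1 \<and> (y, x) \<in> \<omega>1 \<longleftrightarrow> (x, y) \<in> \<omega> \<and> (y, x) \<in> \<omega> \<or> x \<in> M \<and> y \<in> M" for x y
    unfolding \<omega>1_def using I_down O_up IO MIO by blast
  have M_closed: "x \<in> M \<longleftrightarrow> y \<in> M" if "(x, y) \<in> \<omega>" "(y, x) \<in> \<omega>" for x y
    using that trans unfolding M_def cls_def by blast
  have cls1: "cls \<omega>1 x = (if x \<in> M then M else cls \<omega> x)" for x
    using M_closed[of x] unfolding cls_def eqv by auto
  have joins: "joins n \<omega> \<omega>1 a b"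
    using cls1 a bn unfolding joins_def M_def by blast
  have "trans \<omega>1"
    unfolding trans_def \<omega>1_def using trans I_down O_up by blast
  then have pre: "preorder_on {1..n} \<omega>1"
    using preorder In unfolding preorder_on_def refl_on_def \<omega>1_def by blast
  \<comment> \<open>Classes at or left of \<open>b\<close> belong to \<open>K\<close> and are
    comparable with \<open>b\<close> in \<open>\<omega>'\<close>, where classes are larger; those
    right of \<open>b\<close> are already above \<open>a\<close> or \<open>b\<close> in
    \<open>\<omega>\<close>.\<close>
  have near: "(e, b) \<in> \<omega>1 \<or> (b, e) \<in> \<omega>1" if e: "e \<in> {1..n}" "meets M (cls \<omega> e)" for e
  proof (cases "wl e b")
    case True
    then have "e \<in> K" using e by (auto simp: K_def)
    moreover have "meets (cls \<omega>' b) (cls \<omega>' e)"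
      using e(2) by (rule meets_mono) (use M' cls_mono in \<open>auto simp: cls_def\<close>)
    ultimately have "e \<in> I \<or> e \<in> O'"
      using up.comparable[OF bn e(1)] refl[OF e(1)] unfolding I_def O'_def by blast
    then show ?thesis using abM MIO unfolding \<omega>1_def by blast
  next
    case False
    then have "wl b e" "wl a e" using a bn wl_total wl_trans by blast+
    then have "(a, e) \<in> \<omega> \<or> (b, e) \<in> \<omega>" using comparable_right_of_pair e(2) M_def by simp
    then have "e \<in> O'" using abM unfolding O'_def by blast
    then show ?thesis using abM MIO unfolding \<omega>1_def by blast
  qed
  have M1: "(x, b) \<in> \<omega>1" "(b, x) \<in> \<omega>1" if "x \<in> M" for x
    using eqv[of x b] that abM by auto
  have comp1: "(x, y) \<in> \<omega>1 \<or> (y, x) \<in> \<omega>1"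
    if xy: "x \<in> {1..n}" "y \<in> {1..n}" "meets (cls \<omega>1 x) (cls \<omega>1 y)" for x y
  proof -
    consider "x \<in> M" "y \<in> M" | "x \<in> M" "y \<notin> M" | "x \<notin> M" "y \<in> M" | "x \<notin> M" "y \<notin> M" by blast
    then show ?thesis
    proof cases
      case 1
      then show ?thesis using eqv by blast
    next
      case 2
      then have "meets M (cls \<omega> y)" using xy(3) by (simp add: cls1)
      then show ?thesis using near xy(2) M1[OF 2(1)] \<open>trans \<omega>1\<close> unfolding trans_def by blast
    next
      case 3
      then have "meets M (cls \<omega> x)" using xy(3) by (simp add: cls1 meets_sym)
      then show ?thesis using near xy(1) M1[OF 3(2)] \<open>trans \<omega>1\<close> unfolding trans_def by blast
    next
      case 4
      then show ?thesis using comparable xy sub(1) by (auto simp: cls1)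
    qed
  qed
  have cls_sub: "cls \<omega> x \<subseteq> cls \<omega>1 x" for x using sub(1) by (auto simp: cls_def)
  have "local_rel \<omega> \<subseteq> local_rel \<omega>1"
    unfolding local_rel_def using sub(1) meets_mono cls_sub by blast
  then have old: "\<omega> \<subseteq> (local_rel \<omega>1)\<^sup>+"
    using generated trancl_mono_subset by blast
  have within: "(x, y) \<in> (local_rel \<omega>1)\<^sup>+"
    if "(x, y) \<in> \<omega>1" "meets (cls \<omega>1 x) (cls \<omega>1 y)" for x y
    using that by (auto simp: local_rel_def)
  have meets_b: "meets (cls \<omega>1 b) (cls \<omega>1 s)" if "s \<in> M \<or> s \<in> K" for s
  proof (cases "s \<in> M")
    case True
    then show ?thesis using abM meets_common by (auto simp: cls1)
  next
    case False
    then show ?thesis using that abM cls1[of b] cls1[of s] by (auto simp: K_def)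
  qed
  \<comment> \<open>New pairs factor through \<open>b\<close>: from \<open>x\<close> to
    \<open>s\<close> inside \<open>\<omega>\<close>, then from \<open>s\<close> to \<open>b\<close>
    by one local step of \<open>\<omega>1\<close>. \<open>step_O\<close> is the other half.\<close>
  have step_I: "(x, b) \<in> (local_rel \<omega>1)\<^sup>+" if x: "x \<in> I" for x
  proof -
    obtain s where s: "(x, s) \<in> \<omega>" "s \<in> M \<or> s \<in> K \<and> (s, b) \<in> \<omega>'"
      using x unfolding I_def by blast
    have "(s, b) \<in> \<omega>1"
      using s refl dom MIO abM unfolding \<omega>1_def I_def by blast
    moreover have "meets (cls \<omega>1 s) (cls \<omega>1 b)"
      using s(2) meets_b meets_sym by blast
    ultimately show ?thesis using within old s(1) by (meson subsetD trancl_trans)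
  qed
  have step_O: "(b, x) \<in> (local_rel \<omega>1)\<^sup>+" if x: "x \<in> O'" for x
  proof -
    obtain s where s: "(s, x) \<in> \<omega>" "s \<in> M \<or> s \<in> K \<and> (b, s) \<in> \<omega>'"
      using x unfolding O'_def by blast
    have "(b, s) \<in> \<omega>1"
      using s refl dom MIO abM unfolding \<omega>1_def O'_def by blast
    moreover have "meets (cls \<omega>1 b) (cls \<omega>1 s)"
      using s(2) meets_b by blast
    ultimately show ?thesis using within old s(1) by (meson subsetD trancl_trans)
  qed
  have "\<omega>1 \<subseteq> (local_rel \<omega>1)\<^sup>+"
  proof
    fix p assume "p \<in> \<omega>1"
    then consider "p \<in> \<omega>" | x y where "p = (x, y)" "x \<in> I" "y \<in> O'" unfolding \<omega>1_def by blast
    then show "p \<in> (local_rel \<omega>1)\<^sup>+"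
      using old trancl_trans[OF step_I step_O] by cases auto
  qed
  with pre comp1 have "perm_preorder n \<omega>1" by unfold_locales blast+
  with sub joins show thesis using that by blast
qed

end

text \<open>Used in both directions, this gives uniqueness of the atom at the first collision. Both
  relations have the same classes, and overlapping classes oriented differently would be equivalent
  in \<open>\<omega>'\<close>. Away from \<open>M\<close> the orientation comes from
  \<open>\<omega>\<close>; next to \<open>M\<close> such a class lies right of \<open>b1\<close>,
  where \<open>joins_right_of_pair\<close> fixes it.\<close>

lemma joins_first_collision_subset:
  assumes ext: "perm_extension n \<omega> \<omega>'" "perm_extension n \<omega> \<omega>1" "perm_extension n \<omega> \<omega>2"
    and sub: "\<omega>1 \<subseteq> \<omega>'" "\<omega>2 \<subseteq> \<omega>'"
    and joins: "joins n \<omega> \<omega>1 a1 b1" "joins n \<omega> \<omega>2 a2 b2"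
    and first: "first_collision n \<omega> \<omega>' b1" "first_collision n \<omega> \<omega>' b2"
  shows "\<omega>1 \<subseteq> \<omega>2"
proof -
  interpret perm_extension n \<omega> \<omega>' by (fact ext)
  interpret e1: perm_extension n \<omega> \<omega>1 by (fact ext)
  interpret e2: perm_extension n \<omega> \<omega>2 by (fact ext)
  have n: "a1 \<in> {1..n}" "b1 \<in> {1..n}" "\<not> wl b1 a1" "a2 \<in> {1..n}" "b2 \<in> {1..n}" "\<not> wl b2 a2"
    using joins by (auto simp: joins_def)
  have a1: "cls \<omega>' a1 = cls \<omega>' b1"
  proof -
    have "cls \<omega>1 a1 = cls \<omega>1 b1"
      using joins(1) n in_cls_self[of a1] in_cls_self[of b1] by (auto simp: joins_def)
    then show ?thesis using sub(1) e1.up.cls_eq_iff up.cls_eq_iff n by blast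
  qed
  have a2: "cls \<omega>' a2 = cls \<omega>' b2"
  proof -
    have "cls \<omega>2 a2 = cls \<omega>2 b2"
      using joins(2) n in_cls_self[of a2] in_cls_self[of b2] by (auto simp: joins_def)
    then show ?thesis using sub(2) e2.up.cls_eq_iff up.cls_eq_iff n by blast
  qed
  have "wl b1 b2" "wl b2 b1" using first by (auto simp: first_collision_def)
  then have b: "cls \<omega> b1 = cls \<omega> b2" using wl_antisym cls_eq_iff n by blast
  have "\<not> wl b1 a2" using n(6) \<open>wl b2 b1\<close> wl_trans by blast
  then have a: "cls \<omega> a1 = cls \<omega> a2"
    using cls_eq_before_first_collision[OF first(1) n(1,4,3)] a1 a2 cls_eq_mono[OF n(2) b] by simp
  define M where "M = cls \<omega> a1 \<union> cls \<omega> b1"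
  have cls1: "cls \<omega>1 x = (if x \<in> M then M else cls \<omega> x)" if "x \<in> {1..n}" for x
    using joins(1) that by (simp add: joins_def M_def)
  have cls2: "cls \<omega>2 x = cls \<omega>1 x" if "x \<in> {1..n}" for x
    using joins(2) that a b by (simp add: cls1 joins_def M_def)
  have bM: "b1 \<in> M" "b2 \<in> M" "cls \<omega>1 b1 = M" "cls \<omega>2 b2 = M"
    using in_cls_self n b cls2[OF n(5)] cls1[OF n(5)] cls1[OF n(2)] by (auto simp: M_def)
  have M': "cls \<omega>' x = cls \<omega>' b1" if "x \<in> M" for x
    using that a1 cls_eqI cls_eq_mono n unfolding M_def by (metis Un_iff up.cls_eqI cls_mono subsetD)
  \<comment> \<open>Such an \<open>x\<close> is equivalent to \<open>b1\<close> in
    \<open>\<omega>'\<close>; at or left of \<open>b1\<close> it would belong to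
    \<open>M\<close>.\<close>
  have outside: "\<not> wl x b1"
    if "x \<in> {1..n}" "x \<notin> M" "y \<in> M" "(x, y) \<in> \<omega>'" "(y, x) \<in> \<omega>'" for x y
    using that first_collision_partner[OF first(1) n(1,3) a1, of x] up.cls_eq_iff[of x y] M'[of y]
    unfolding M_def by auto
  have "local_rel \<omega>1 \<subseteq> \<omega>2"
  proof
    fix p assume "p \<in> local_rel \<omega>1"
    then obtain u v where p: "p = (u, v)" and uv: "(u, v) \<in> \<omega>1" "meets (cls \<omega>1 u) (cls \<omega>1 v)"
      by (auto simp: local_rel_def)
    have un: "u \<in> {1..n}" "v \<in> {1..n}" using e1.up.dom[OF uv(1)] by auto
    have "(u, v) \<in> \<omega>2"
    proof (rule ccontr)
      assume not: "(u, v) \<notin> \<omega>2"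
      then have vu: "(v, u) \<in> \<omega>2" using e2.up.comparable[OF un] uv(2) un by (simp add: cls2)
      have eq: "cls \<omega>1 u \<noteq> cls \<omega>1 v" using not un e2.up.cls_eq_iff[OF un(1), of v] by (simp add: cls2)
      then have not1: "(v, u) \<notin> \<omega>1" using e1.up.cls_eq_iff[OF un(1), of v] uv(1) by blast
      \<comment> \<open>Opposite orientations in two relations below \<open>\<omega>'\<close> make
        \<open>u\<close> and \<open>v\<close> equivalent there, which is what \<open>outside\<close>
        needs.\<close>
      have rel': "(u, v) \<in> \<omega>'" "(v, u) \<in> \<omega>'" using uv(1) vu sub by auto
      have "\<not> (u \<in> M \<and> v \<in> M)" using eq un cls1 by auto
      then consider "u \<notin> M" "v \<notin> M" | "u \<in> M" "v \<notin> M" | "u \<notin> M" "v \<in> M" by blast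
      then show False
      proof cases
        case 1
        then have "(u, v) \<in> \<omega> \<or> (v, u) \<in> \<omega>" using comparable[OF un] uv(2) un by (simp add: cls1)
        then show False using not not1 e1.extends e2.extends by blast
      next
        case 2
        then have "\<not> wl v b1" using outside rel' un by blast
        then have "\<not> wl v b2" using \<open>wl b2 b1\<close> wl_trans by blast
        moreover have "meets (cls \<omega>2 b2) (cls \<omega> v)" using uv(2) un 2 bM by (simp add: cls1)
        ultimately show False using e2.joins_right_of_pair[OF joins(2) un(2)] 2 bM not by blast
      next
        case 3
        then have "\<not> wl u b1" using outside rel' un by blast
        moreover have "meets (cls \<omega>1 b1) (cls \<omega> u)"
          using uv(2) un 3 bM by (simp add: cls1 meets_sym)
        ultimately show False using e1.joins_right_of_pair[OF joins(1) un(1)] 3 bM not1 by blast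
      qed
    qed
    then show "p \<in> \<omega>2" using p by simp
  qed
  then have "(local_rel \<omega>1)\<^sup>+ \<subseteq> \<omega>2\<^sup>+" by (rule trancl_mono_subset)
  also have "\<omega>2\<^sup>+ = \<omega>2" by (rule trancl_id) (auto simp: trans_def intro: e2.up.trans)
  finally show ?thesis using e1.up.generated by blast
qed

section \<open>Blocks and placements\<close>

lemma overlap_iff_meets:
  assumes "finite A" "A \<noteq> {}" "finite B" "B \<noteq> {}"
  shows "overlap A B \<longleftrightarrow> meets A B"
proof -
  have "Min A \<le> Max A" "Min B \<le> Max B" using assms by (meson Max_ge Min_in)+
  then have "overlap A B \<longleftrightarrow> Min A \<le> Max B \<and> Min B \<le> Max A"
    by (auto simp: overlap_def)
  also have "\<dots> \<longleftrightarrow> meets A B"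
    unfolding meets_def using assms by (auto simp: Min_le_iff Max_ge_iff)
  finally show ?thesis .
qed

lemma blocks_eq:
  assumes "preorder_on {1..n} \<omega>"
  shows "blocks \<omega> = cls \<omega> ` {1..n}"
proof -
  have "Field \<omega> = {1..n}"
    using assms by (auto simp: preorder_on_def refl_on_def Field_def)
  moreover have "(\<omega> \<inter> \<omega>\<inverse>) `` {x} = cls \<omega> x" for x by (auto simp: cls_def)
  ultimately show ?thesis by (auto simp: blocks_def quotient_def)
qed

lemma block_le_cls:
  assumes "preorder_on {1..n} \<omega>" "x \<in> {1..n}" "y \<in> {1..n}"
  shows "block_le \<omega> (cls \<omega> x) (cls \<omega> y) \<longleftrightarrow> (x, y) \<in> \<omega>"
  using assms unfolding block_le_def cls_def preorder_on_def refl_on_def trans_def by blast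

lemma block_less_cls:
  assumes "preorder_on {1..n} \<omega>" "x \<in> {1..n}" "y \<in> {1..n}"
  shows "block_less \<omega> (cls \<omega> x) (cls \<omega> y) \<longleftrightarrow> (x, y) \<in> \<omega> \<and> (y, x) \<notin> \<omega>"
proof -
  have "cls \<omega> x = cls \<omega> y \<longleftrightarrow> (x, y) \<in> \<omega> \<and> (y, x) \<in> \<omega>"
    using assms unfolding cls_def preorder_on_def refl_on_def trans_def by blast
  then show ?thesis using block_le_cls[OF assms] by (auto simp: block_less_def)
qed

lemma overlap_cls:
  assumes "preorder_on {1..n} \<omega>" "x \<in> {1..n}" "y \<in> {1..n}"
  shows "overlap (cls \<omega> x) (cls \<omega> y) \<longleftrightarrow> meets (cls \<omega> x) (cls \<omega> y)"
proof (rule overlap_iff_meets)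
  have "cls \<omega> z \<subseteq> {1..n}" for z using assms(1) by (auto simp: cls_def preorder_on_def)
  then show "finite (cls \<omega> x)" "finite (cls \<omega> y)" by (auto intro: finite_subset)
  show "cls \<omega> x \<noteq> {}" "cls \<omega> y \<noteq> {}"
    using assms by (auto simp: cls_def preorder_on_def refl_on_def)
qed

text \<open>Induction on the size of the interval from \<open>x\<close> to \<open>y\<close>: if the
  classes do not overlap, (P2) denies that they form a cover, and a class strictly between them
  splits the interval.\<close>

lemma perm_preorders_generated:
  assumes "\<omega> \<in> perm_preorders n"
  shows "\<omega> \<subseteq> (local_rel \<omega>)\<^sup>+"
proof -
  have pre: "preorder_on {1..n} \<omega>"
    and cover: "\<And>B B'. B \<in> blocks \<omega> \<Longrightarrow> B' \<in> blocks \<omega> \<Longrightarrow> block_covered_by \<omega> B B' \<Longrightarrow> overlap B B'"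
    using assms by (auto simp: perm_preorders_def)
  have refl: "\<And>x. x \<in> {1..n} \<Longrightarrow> (x, x) \<in> \<omega>"
    and dom: "\<And>x y. (x, y) \<in> \<omega> \<Longrightarrow> x \<in> {1..n} \<and> y \<in> {1..n}"
    and trans: "\<And>x y z. (x, y) \<in> \<omega> \<Longrightarrow> (y, z) \<in> \<omega> \<Longrightarrow> (x, z) \<in> \<omega>"
    using pre unfolding preorder_on_def refl_on_def trans_def by blast+
  have "(x, y) \<in> (local_rel \<omega>)\<^sup>+" if "(x, y) \<in> \<omega>" for x y
    using that
  proof (induction "card {z. (x, z) \<in> \<omega> \<and> (z, y) \<in> \<omega>}" arbitrary: x y rule: less_induct)
    case less
    have n: "x \<in> {1..n}" "y \<in> {1..n}" using dom[OF less.prems] by auto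
    have fin: "finite {z. (x, z) \<in> \<omega> \<and> (z, y) \<in> \<omega>}" for x y
      by (rule finite_subset[of _ "{1..n}"]) (use dom in auto)
    show ?case
    proof (cases "meets (cls \<omega> x) (cls \<omega> y)")
      case True
      with less.prems show ?thesis by (auto simp: local_rel_def)
    next
      case False
      then have "\<not> block_covered_by \<omega> (cls \<omega> x) (cls \<omega> y)"
        using cover n overlap_cls[OF pre n] blocks_eq[OF pre] by blast
      moreover have "(y, x) \<notin> \<omega>"
      proof
        assume "(y, x) \<in> \<omega>"
        with less.prems refl[OF n(1)] have "x \<in> cls \<omega> x" "x \<in> cls \<omega> y" by (auto simp: cls_def)
        with False meets_common show False by blast
      qed
      ultimately obtain z where z: "z \<in> {1..n}" "(x, z) \<in> \<omega>" "(z, x) \<notin> \<omega>" "(z, y) \<in> \<omega>" "(y, z) \<notin> \<omega>"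
        using less.prems n block_less_cls[OF pre] blocks_eq[OF pre]
        by (auto simp: block_covered_by_def)
      \<comment> \<open>The element \<open>y\<close> drops out here, and \<open>x\<close> drops out
        of the other half.\<close>
      have "{w. (x, w) \<in> \<omega> \<and> (w, z) \<in> \<omega>} \<subset> {w. (x, w) \<in> \<omega> \<and> (w, y) \<in> \<omega>}"
        using z less.prems refl[OF n(2)] trans by blast
      then have 1: "(x, z) \<in> (local_rel \<omega>)\<^sup>+"
        using less.hyps z(2) psubset_card_mono[OF fin] by blast
      have "{w. (z, w) \<in> \<omega> \<and> (w, y) \<in> \<omega>} \<subset> {w. (x, w) \<in> \<omega> \<and> (w, y) \<in> \<omega>}"
        using z less.prems refl[OF n(1)] trans by blast
      then have 2: "(z, y) \<in> (local_rel \<omega>)\<^sup>+"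
        using less.hyps z(4) psubset_card_mono[OF fin] by blast
      from 1 2 show ?thesis by (rule trancl_trans)
    qed
  qed
  then show ?thesis by auto
qed

text \<open>A local step on the way from \<open>x\<close> to \<open>y\<close> leaves the down-set of
  \<open>x\<close>. As nothing lies strictly between, it starts in the class of \<open>x\<close> and
  ends in that of \<open>y\<close>.\<close>

lemma (in perm_preorder) cover_overlap:
  assumes n: "x \<in> {1..n}" "y \<in> {1..n}" and cover: "block_covered_by \<omega> (cls \<omega> x) (cls \<omega> y)"
  shows "meets (cls \<omega> x) (cls \<omega> y)"
proof -
  have xy: "(x, y) \<in> \<omega>" "(y, x) \<notin> \<omega>"
    and no: "\<And>z. (x, z) \<in> \<omega> \<Longrightarrow> (z, x) \<notin> \<omega> \<Longrightarrow> (z, y) \<in> \<omega> \<Longrightarrow> (y, z) \<in> \<omega>"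
    using cover n block_less_cls[OF preorder] blocks_eq[OF preorder] dom
    by (auto simp: block_covered_by_def)
  obtain u v where uv: "(x, u) \<in> \<omega>" "(u, v) \<in> \<omega>" "(v, y) \<in> \<omega>" "(u, x) \<in> \<omega>" "(v, x) \<notin> \<omega>"
    "meets (cls \<omega> u) (cls \<omega> v)"
    by (rule local_exit[of x y "{z. (z, x) \<in> \<omega>}"]) (use xy refl n in auto)
  have "cls \<omega> u = cls \<omega> x" using uv cls_eq_iff n by blast
  moreover have "cls \<omega> v = cls \<omega> y"
    using uv no[of v] trans[OF uv(1,2)] cls_eq_iff[OF n(2)] by blast
  ultimately show ?thesis using uv(6) by simp
qed

lemma perm_preorders_iff: "\<omega> \<in> perm_preorders n \<longleftrightarrow> perm_preorder n \<omega>"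
proof
  assume \<omega>: "\<omega> \<in> perm_preorders n"
  then have pre: "preorder_on {1..n} \<omega>" by (simp add: perm_preorders_def)
  show "perm_preorder n \<omega>"
  proof
    show "\<omega> \<subseteq> (local_rel \<omega>)\<^sup>+" using \<omega> by (rule perm_preorders_generated)
    fix x y assume xy: "x \<in> {1..n}" "y \<in> {1..n}" "meets (cls \<omega> x) (cls \<omega> y)"
    then have "block_comparable \<omega> (cls \<omega> x) (cls \<omega> y)"
      using \<omega> overlap_cls[OF pre] blocks_eq[OF pre] by (auto simp: perm_preorders_def)
    then show "(x, y) \<in> \<omega> \<or> (y, x) \<in> \<omega>"
      using block_le_cls[OF pre] xy by (auto simp: block_comparable_def)
  qed (fact pre)
next
  assume "perm_preorder n \<omega>"
  then interpret perm_preorder n \<omega> .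
  show "\<omega> \<in> perm_preorders n"
    unfolding perm_preorders_def mem_Collect_eq blocks_eq[OF preorder]
    using preorder comparable cover_overlap
    by (auto simp: overlap_cls[OF preorder] block_comparable_def block_le_cls[OF preorder]
        simp del: atLeastAtMost_iff)
qed

text \<open>Makes the \<open>THE\<close> in \<open>block_sequence\<close> well defined: applying
  \<open>f\<close> turns such a list into the sorted list of the keys, and injectivity recovers the
  list from it.\<close>

lemma sorted_wrt_key_unique:
  fixes f :: "'a \<Rightarrow> nat"
  assumes inj: "inj_on f S" and R: "\<And>x y. x \<in> S \<Longrightarrow> y \<in> S \<Longrightarrow> R x y \<longleftrightarrow> f x < f y"
    and fin: "finite S"
  shows "\<exists>!xs. distinct xs \<and> set xs = S \<and> sorted_wrt R xs"
proof -
  have key: "distinct xs \<and> set xs = S \<and> sorted_wrt R xs \<longleftrightarrow>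
      set xs = S \<and> map f xs = sorted_list_of_set (f ` S)" for xs
  proof
    assume xs: "distinct xs \<and> set xs = S \<and> sorted_wrt R xs"
    then have "sorted_wrt (\<lambda>x y. f x < f y) xs"
      using R by (auto intro: sorted_wrt_mono_rel[rotated])
    then have "sorted_wrt (<) (map f xs)" by (simp add: sorted_wrt_map)
    then show "set xs = S \<and> map f xs = sorted_list_of_set (f ` S)" using xs
      by (metis list.set_map sorted_list_of_set.idem_if_sorted_distinct strict_sorted_iff)
  next
    assume "set xs = S \<and> map f xs = sorted_list_of_set (f ` S)"
    then have xs: "set xs = S" "map f xs = sorted_list_of_set (f ` S)" by auto
    then have "sorted_wrt (<) (map f xs)" by (metis strict_sorted_list_of_set)
    then have "sorted_wrt (\<lambda>x y. f x < f y) xs" by (simp add: sorted_wrt_map)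
    then have "sorted_wrt R xs" using R xs(1) by (auto intro: sorted_wrt_mono_rel[rotated])
    moreover have "distinct xs" using xs(2) by (metis distinct_map distinct_sorted_list_of_set)
    ultimately show "distinct xs \<and> set xs = S \<and> sorted_wrt R xs" using xs(1) by simp
  qed
  have "\<exists>!xs. set xs = S \<and> map f xs = sorted_list_of_set (f ` S)"
  proof (rule ex1I)
    let ?xs = "map (inv_into S f) (sorted_list_of_set (f ` S))"
    show "set ?xs = S \<and> map f ?xs = sorted_list_of_set (f ` S)"
      using fin inj by (auto simp: f_inv_into_f intro!: map_idI)
  next
    fix xs assume xs: "set xs = S \<and> map f xs = sorted_list_of_set (f ` S)"
    have "map (inv_into S f \<circ> f) xs = xs"
      by (rule map_idI) (use inj xs in auto)
    then show "xs = map (inv_into S f) (sorted_list_of_set (f ` S))"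
      using xs by (metis map_map)
  qed
  then show ?thesis by (simp only: key)
qed

section \<open>Placements as counts of classes\<close>

context perm_preorder
begin

text \<open>For incomparable classes, \<open>less_of_incomparable\<close> puts one entirely below
  the other, so \<open>Max\<close> and \<open>Min\<close> decide as any two representatives
  do.\<close>

lemma left_of_cls:
  assumes n: "x \<in> {1..n}" "y \<in> {1..n}"
  shows "left_of \<omega> (cls \<omega> x) (cls \<omega> y) \<longleftrightarrow> \<not> wl y x"
proof (cases "(x, y) \<in> \<omega> \<or> (y, x) \<in> \<omega>")
  case True
  then show ?thesis
    using block_less_cls[OF preorder n] block_le_cls[OF preorder] n
    by (auto simp: left_of_def block_comparable_def weakly_left_def)
next
  case False
  have fin: "finite (cls \<omega> z)" for z by (rule finite_subset[OF cls_subset]) simp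
  have ne: "cls \<omega> x \<noteq> {}" "cls \<omega> y \<noteq> {}" using in_cls_self n by auto
  have "Max (cls \<omega> x) < Min (cls \<omega> y) \<longleftrightarrow> \<not> wl y x"
  proof
    assume "Max (cls \<omega> x) < Min (cls \<omega> y)"
    then have "x < y" using fin in_cls_self n by (auto simp: ne)
    then show "\<not> wl y x" using False by (auto simp: weakly_left_def)
  next
    assume "\<not> wl y x"
    then have "wl x y" using wl_total n by blast
    then show "Max (cls \<omega> x) < Min (cls \<omega> y)"
      using less_of_incomparable[of _ x _ y] False fin ne by auto
  qed
  then show ?thesis
    using False block_less_cls[OF preorder n] block_le_cls[OF preorder] n
    by (auto simp: left_of_def block_comparable_def)
qed

lemma placement_cls:
  assumes x: "x \<in> {1..n}"
  shows "placement \<omega> (cls \<omega> x) = pl n \<omega> x"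
proof -
  \<comment> \<open>\<open>Min\<close> picks a representative, which turns \<open>pl\<close> into a
    key on blocks.\<close>
  define f where "f B = pl n \<omega> (Min B)" for B
  have Min_cls: "Min (cls \<omega> z) \<in> cls \<omega> z" if "z \<in> {1..n}" for z
    using that in_cls_self finite_subset[OF cls_subset] by (intro Min_in) auto
  have f: "f (cls \<omega> z) = pl n \<omega> z" if "z \<in> {1..n}" for z
    using Min_cls[OF that] wl_rel pl_mono unfolding f_def cls_def by (blast intro: order.antisym)
  have bl: "blocks \<omega> = cls \<omega> ` {1..n}" using blocks_eq[OF preorder] .
  have less: "left_of \<omega> B C \<longleftrightarrow> f B < f C" if "B \<in> blocks \<omega>" "C \<in> blocks \<omega>" for B C
    using that pl_le_iff left_of_cls f unfolding bl by (auto simp: not_le[symmetric])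
  have inj: "inj_on f (blocks \<omega>)"
  proof (rule inj_onI)
    fix B C assume "B \<in> blocks \<omega>" "C \<in> blocks \<omega>" "f B = f C"
    then obtain y z where "B = cls \<omega> y" "C = cls \<omega> z" "y \<in> {1..n}" "z \<in> {1..n}" "pl n \<omega> y = pl n \<omega> z"
      unfolding bl by (auto simp: f)
    then show "B = C" using pl_le_iff[of y z] pl_le_iff[of z y] wl_antisym cls_eq_iff by simp
  qed
  let ?Bs = "block_sequence \<omega>"
  have Bs: "distinct ?Bs" "set ?Bs = blocks \<omega>" "sorted_wrt (left_of \<omega>) ?Bs"
    using theI'[OF sorted_wrt_key_unique[OF inj less]] unfolding block_sequence_def bl by auto
  have "cls \<omega> x \<in> set ?Bs" using x bl Bs(2) by blast
  then obtain i where i: "i < length ?Bs" "?Bs ! i = cls \<omega> x" by (auto simp: in_set_conv_nth)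
  then have "placement \<omega> (cls \<omega> x) = Suc i"
    unfolding placement_def using nth_eq_iff_index_eq[OF Bs(1)]
    by (intro arg_cong[of _ _ Suc] the_equality) (simp, metis)
  \<comment> \<open>Position \<open>i\<close> counts from 0, so the first \<open>Suc i\<close>
    entries are the blocks up to and including that of \<open>x\<close>.\<close>
  also have "Suc i = card (set (take (Suc i) ?Bs))"
    using Bs(1) i(1) by (subst distinct_card) auto
  also have "set (take (Suc i) ?Bs) = (!) ?Bs ` {0..<Suc i}"
    using i(1) by (simp add: nth_image)
  also have "(!) ?Bs ` {0..<Suc i} = cls \<omega> ` {z \<in> {1..n}. wl z x}"
  proof (intro equalityI subsetI)
    fix B assume "B \<in> (!) ?Bs ` {0..<Suc i}"
    then obtain k where "k \<in> {0..<Suc i}" "B = ?Bs ! k" by blast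
    then have k: "k \<le> i" "B = ?Bs ! k" by auto
    then have "B \<in> blocks \<omega>" using i(1) Bs(2) nth_mem[of k ?Bs] by auto
    then obtain z where z: "z \<in> {1..n}" "B = cls \<omega> z" unfolding bl by blast
    have "wl z x"
    proof (cases "k = i")
      case True
      then show ?thesis using z k(2) i(2) cls_eq_iff[OF z(1)] wl_rel by metis
    next
      case False
      then have "left_of \<omega> (cls \<omega> z) (cls \<omega> x)"
        using k i z sorted_wrt_nth_less[OF Bs(3), of k i] by simp
      then show ?thesis using left_of_cls[OF z(1) x] wl_total[OF z(1)] by blast
    qed
    then show "B \<in> cls \<omega> ` {z \<in> {1..n}. wl z x}" using z by blast
  next
    fix B assume "B \<in> cls \<omega> ` {z \<in> {1..n}. wl z x}"
    then obtain z where z: "z \<in> {1..n}" "B = cls \<omega> z" "wl z x" by blast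
    then have "B \<in> set ?Bs" using bl Bs(2) by blast
    then obtain k where k: "k < length ?Bs" "B = ?Bs ! k" by (auto simp: in_set_conv_nth)
    have "\<not> i < k"
      using sorted_wrt_nth_less[OF Bs(3), of i k] k i left_of_cls[OF x z(1)] z by auto
    then show "B \<in> (!) ?Bs ` {0..<Suc i}" using k by auto
  qed
  also have "card \<dots> = pl n \<omega> x" by (simp add: pl_def)
  finally show ?thesis .
qed

end

context perm_extension
begin

text \<open>A union of two distinct blocks is never a block of \<open>\<omega>\<close>, so the
  merged pair is recovered as \<open>blocks \<omega> - blocks \<omega>'\<close>. This makes the
  \<open>THE\<close> in \<open>cover_label\<close> well defined.\<close>

lemma joins_merges_iff:
  assumes j: "joins n \<omega> \<omega>' a b"
  shows "merges \<omega> \<omega>' B C \<longleftrightarrow> {B, C} = {cls \<omega> a, cls \<omega> b}"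
proof -
  have ab: "a \<in> {1..n}" "b \<in> {1..n}" "\<not> wl b a" using j by (auto simp: joins_def)
  have bl: "blocks \<omega> = cls \<omega> ` {1..n}" "blocks \<omega>' = cls \<omega>' ` {1..n}"
    using blocks_eq preorder up.preorder by auto
  have "cls \<omega> a \<noteq> cls \<omega> b" using ab cls_eq_iff[of a b] wl_rel by blast
  then have merges: "merges \<omega> \<omega>' (cls \<omega> a) (cls \<omega> b)"
    using joins_image(1)[OF j _ ab(1,2)] ab unfolding merges_def bl by blast
  have union_new: "B \<union> C \<notin> blocks \<omega>" if BC: "B \<in> blocks \<omega>" "C \<in> blocks \<omega>" "B \<noteq> C" for B C
  proof
    assume "B \<union> C \<in> blocks \<omega>"
    moreover obtain x y where "B = cls \<omega> x" "C = cls \<omega> y" "x \<in> B" "y \<in> C"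
      using BC(1,2) in_cls_self unfolding bl by blast
    ultimately have "B = B \<union> C" "C = B \<union> C" using cls_eqI unfolding bl by blast+
    then show False using BC(3) by simp
  qed
  have "{} \<notin> blocks \<omega>" using in_cls_self unfolding bl by blast
  then have diff: "blocks \<omega> - blocks \<omega>' = {B, C}" if "merges \<omega> \<omega>' B C" for B C
    using that union_new[of B C] unfolding merges_def by auto
  show ?thesis
  proof
    assume "merges \<omega> \<omega>' B C"
    then show "{B, C} = {cls \<omega> a, cls \<omega> b}" using diff merges by metis
  next
    assume "{B, C} = {cls \<omega> a, cls \<omega> b}"
    then have "B = cls \<omega> a \<and> C = cls \<omega> b \<or> B = cls \<omega> b \<and> C = cls \<omega> a"
      by (auto simp: doubleton_eq_iff)
    then show "merges \<omega> \<omega>' B C"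
      using merges by (auto simp: merges_def Un_commute insert_commute)
  qed
qed

lemma joins_card_blocks:
  assumes j: "joins n \<omega> \<omega>' a b"
  shows "card (blocks \<omega>) = Suc (card (blocks \<omega>'))"
proof -
  have "a \<in> {1..n}" "b \<in> {1..n}" using j by (auto simp: joins_def)
  then show ?thesis
    unfolding blocks_eq[OF preorder] blocks_eq[OF up.preorder] by (rule joins_image(2)[OF j subset_refl])
qed

lemma cover_label_joins:
  assumes j: "joins n \<omega> \<omega>' a b"
  shows "cover_label \<omega> \<omega>' = pl n \<omega> b"
proof -
  have ab: "a \<in> {1..n}" "b \<in> {1..n}" "\<not> wl b a" using j by (auto simp: joins_def)
  have "placement \<omega> (cls \<omega> a) \<le> placement \<omega> (cls \<omega> b)"
    using ab pl_less[of b a] by (simp add: placement_cls)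
  then have "max (placement \<omega> B) (placement \<omega> C) = pl n \<omega> b" if "merges \<omega> \<omega>' B C" for B C
    using that joins_merges_iff[OF j] placement_cls[OF ab(2)]
    by (auto simp: doubleton_eq_iff max_def)
  moreover have "merges \<omega> \<omega>' (cls \<omega> a) (cls \<omega> b)"
    using joins_merges_iff[OF j] by blast
  ultimately show ?thesis unfolding cover_label_def by (intro the_equality) metis+
qed

end

section \<open>Covers and their labels\<close>

lemma perm_extension_iff:
  "perm_extension n \<omega> \<omega>' \<longleftrightarrow> perm_preorder n \<omega> \<and> perm_preorder n \<omega>' \<and> \<omega> \<subseteq> \<omega>'"
  by (auto simp: perm_extension_def perm_extension_axioms_def)

context perm_extension
begin

text \<open>Sending each block of \<open>\<omega>\<close> to the block of \<open>\<omega>'\<close>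
  containing it is surjective, and a collision shows that it is not injective.\<close>

lemma card_blocks_less:
  assumes "\<omega> \<noteq> \<omega>'"
  shows "card (blocks \<omega>') < card (blocks \<omega>)"
proof -
  obtain b where "first_collision n \<omega> \<omega>' b" using ex_first_collision[OF assms] .
  then obtain x where b: "b \<in> {1..n}" "x \<in> {1..n}" "\<not> wl b x" "cls \<omega>' x = cls \<omega>' b"
    by (auto simp: first_collision_def collisions_def)
  then have neq: "cls \<omega> b \<noteq> cls \<omega> x" using cls_eq_iff wl_rel by blast
  let ?f = "\<lambda>B. cls \<omega>' (Min B)"
  have Min: "?f (cls \<omega> z) = cls \<omega>' z" if "z \<in> {1..n}" for z
  proof -
    have "Min (cls \<omega> z) \<in> cls \<omega> z"
      using that in_cls_self finite_subset[OF cls_subset] by (intro Min_in) auto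
    then show ?thesis using cls_mono up.cls_eqI by blast
  qed
  have "?f ` blocks \<omega> = blocks \<omega>'"
    using Min by (auto simp: blocks_eq[OF preorder] blocks_eq[OF up.preorder] image_iff
        simp del: atLeastAtMost_iff)
  moreover have "\<not> inj_on ?f (blocks \<omega>)"
  proof
    assume "inj_on ?f (blocks \<omega>)"
    moreover have "cls \<omega> b \<in> blocks \<omega>" "cls \<omega> x \<in> blocks \<omega>" using b blocks_eq[OF preorder] by auto
    moreover have "?f (cls \<omega> b) = ?f (cls \<omega> x)" using b Min by simp
    ultimately show False using neq by (meson inj_onD)
  qed
  moreover have "finite (blocks \<omega>)" by (simp add: blocks_eq[OF preorder])
  ultimately show ?thesis by (metis card_image_le eq_card_imp_inj_on le_neq_implies_less)
qed

text \<open>The number of blocks drops by only one, while an element strictly between would make it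
  drop twice.\<close>

lemma joins_covered_by:
  assumes j: "joins n \<omega> \<omega>' a b"
  shows "covered_by (perm_preorders n) (\<subseteq>) \<omega> \<omega>'"
proof -
  have card: "card (blocks \<omega>) = Suc (card (blocks \<omega>'))" using joins_card_blocks[OF j] .
  have "z = \<omega> \<or> z = \<omega>'" if "z \<in> perm_preorders n" "\<omega> \<subseteq> z" "z \<subseteq> \<omega>'" for z
  proof (rule ccontr)
    assume z: "\<not> (z = \<omega> \<or> z = \<omega>')"
    interpret l: perm_extension n \<omega> z
      using that perm_preorder_axioms by (simp add: perm_extension_iff perm_preorders_iff)
    interpret u: perm_extension n z \<omega>'
      using that up.perm_preorder_axioms by (simp add: perm_extension_iff perm_preorders_iff)
    show False using l.card_blocks_less u.card_blocks_less z card by auto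
  qed
  then show ?thesis
    using card extends perm_preorder_axioms up.perm_preorder_axioms
    unfolding covered_by_def perm_preorders_iff[symmetric] by auto
qed

end

text \<open>The atom built by \<open>ex_join\<close> at a first collision lies above
  \<open>\<omega>\<close> and within \<open>\<omega>'\<close>, so a cover must coincide with
  it.\<close>

lemma covered_by_joins:
  assumes "covered_by (perm_preorders n) (\<subseteq>) \<omega> \<omega>'"
  obtains a b where "perm_extension n \<omega> \<omega>'" "joins n \<omega> \<omega>' a b"
proof -
  have cov: "\<omega> \<noteq> \<omega>'" and between: "\<And>z. z \<in> perm_preorders n \<Longrightarrow> \<omega> \<subseteq> z \<Longrightarrow> z \<subseteq> \<omega>' \<Longrightarrow> z = \<omega> \<or> z = \<omega>'"
    and ext: "perm_extension n \<omega> \<omega>'"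
    using assms by (auto simp: covered_by_def perm_extension_iff perm_preorders_iff)
  interpret perm_extension n \<omega> \<omega>' by (fact ext)
  obtain b where "first_collision n \<omega> \<omega>' b" using ex_first_collision[OF cov] .
  then obtain a z where z: "perm_preorder n z" "\<omega> \<subseteq> z" "z \<subseteq> \<omega>'" "joins n \<omega> z a b"
    using ex_join by metis
  interpret z: perm_extension n \<omega> z
    using z perm_preorder_axioms by (simp add: perm_extension_iff)
  have "z \<noteq> \<omega>" using z.joins_card_blocks[OF z(4)] by auto
  then have "z = \<omega>'" using between[of z] z by (simp add: perm_preorders_iff)
  then show thesis using that ext z(4) by blast
qed

section \<open>Collisions and labels after one merge\<close>

lemma joins_cls_eq:
  assumes j: "joins n \<omega> \<omega>1 a b" and ext: "perm_extension n \<omega> \<omega>1" "perm_extension n \<omega>1 \<omega>'"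
  shows "cls \<omega>1 a = cls \<omega>1 b" "cls \<omega>' a = cls \<omega>' b"
proof -
  interpret perm_extension n \<omega> \<omega>1 by (fact ext)
  interpret u: perm_extension n \<omega>1 \<omega>' by (fact ext)
  show "cls \<omega>1 a = cls \<omega>1 b"
    using j in_cls_self[of a] in_cls_self[of b] by (auto simp: joins_def)
  then show "cls \<omega>' a = cls \<omega>' b"
    using j by (intro u.cls_eq_mono) (auto simp: joins_def)
qed

lemma joins_collision:
  assumes "joins n \<omega> \<omega>1 a b" and "perm_extension n \<omega> \<omega>1" "perm_extension n \<omega>1 \<omega>'"
  shows "b \<in> collisions n \<omega> \<omega>'"
  using joins_cls_eq[OF assms] assms(1) by (auto simp: joins_def collisions_def)

text \<open>By \<open>joins_pl\<close>, a smaller label would come from two elements up to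
  \<open>b\<close> still separated in \<open>\<omega>1\<close>. If \<open>\<omega>'\<close> unites
  them with \<open>b\<close>, they were just joined; otherwise both lie strictly left of
  \<open>b\<close>, where minimality puts them in one class of \<open>\<omega>\<close>.\<close>

lemma joins_first_collision_label_le:
  assumes ext: "perm_extension n \<omega> \<omega>1" "perm_extension n \<omega>1 \<omega>'"
    and j: "joins n \<omega> \<omega>1 a b" and b: "first_collision n \<omega> \<omega>' b"
    and d: "d \<in> collisions n \<omega>1 \<omega>'"
  shows "pl n \<omega> b \<le> pl n \<omega>1 d"
proof (rule ccontr)
  interpret perm_extension n \<omega> \<omega>1 by (fact ext)
  interpret u: perm_extension n \<omega>1 \<omega>' by (fact ext)
  interpret c: perm_extension n \<omega> \<omega>'
    using ext by (auto simp: perm_extension_iff)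
  assume "\<not> pl n \<omega> b \<le> pl n \<omega>1 d"
  moreover obtain c where c: "d \<in> {1..n}" "c \<in> {1..n}" "\<not> weakly_left \<omega>1 d c" "cls \<omega>' c = cls \<omega>' d"
    using d by (auto simp: collisions_def)
  moreover from this have "pl n \<omega>1 c < pl n \<omega>1 d" using up.pl_less by blast
  ultimately have wl: "wl c b" "wl d b" using joins_pl[OF j c(1)] joins_pl[OF j c(2)] by simp_all
  have ab: "a \<in> {1..n}" "b \<in> {1..n}" "\<not> wl b a" "cls \<omega>' a = cls \<omega>' b"
    using j joins_cls_eq[OF j ext] by (auto simp: joins_def)
  have neq: "cls \<omega>1 c \<noteq> cls \<omega>1 d"
    using c up.cls_eq_iff up.wl_rel by blast
  show False
  proof (cases "cls \<omega>' c = cls \<omega>' b")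
    case True
    then have "c \<in> cls \<omega> a \<union> cls \<omega> b" "d \<in> cls \<omega> a \<union> cls \<omega> b"
      using c.first_collision_partner[OF b ab(1,3,4)] wl c by auto
    then show False using neq j c(1,2) by (simp add: joins_def)
  next
    case False
    have "\<not> wl b c" "\<not> wl b d"
      using False wl wl_antisym c(4) cls_eq_iff[OF ab(2)] c.cls_eq_mono[OF ab(2)] by metis+
    then have "cls \<omega> c = cls \<omega> d"
      using c.cls_eq_before_first_collision[OF b] c by blast
    then show False using neq cls_eq_mono c(2) by blast
  qed
qed

text \<open>The collision \<open>c\<close> and its partner lie strictly left of \<open>b\<close>, so
  joining \<open>a\<close> and \<open>b\<close> keeps them apart. They still have to be merged, and
  \<open>joins_pl\<close> bounds their placements in \<open>\<omega>1\<close>.\<close>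

lemma joins_later_collision_label_less:
  assumes ext: "perm_extension n \<omega> \<omega>1" "perm_extension n \<omega>1 \<omega>'"
    and j: "joins n \<omega> \<omega>1 a b" and c: "c \<in> collisions n \<omega> \<omega>'" "\<not> weakly_left \<omega> b c"
    and d: "first_collision n \<omega>1 \<omega>' d"
  shows "pl n \<omega>1 d < pl n \<omega> b"
proof -
  interpret perm_extension n \<omega> \<omega>1 by (fact ext)
  interpret u: perm_extension n \<omega>1 \<omega>' by (fact ext)
  obtain c' where c': "c \<in> {1..n}" "c' \<in> {1..n}" "\<not> wl c c'" "cls \<omega>' c' = cls \<omega>' c"
    using c(1) by (auto simp: collisions_def)
  have b: "b \<in> {1..n}" using j by (simp add: joins_def)
  have "wl c' c" "wl c b" using c(2) c' b wl_total by blast+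
  then have W: "wl c b" "wl c' b" "\<not> wl b c'" using c(2) wl_trans by blast+
  have "cls \<omega>1 c' \<noteq> cls \<omega>1 c"
  proof
    assume eq: "cls \<omega>1 c' = cls \<omega>1 c"
    have not_b: "c \<notin> cls \<omega> b" "c' \<notin> cls \<omega> b" using c(2) W(3) wl_rel by (auto simp: cls_def)
    have neq: "cls \<omega> c' \<noteq> cls \<omega> c" using c' cls_eq_iff wl_rel by blast
    have c'_in: "c' \<in> cls \<omega>1 c" using eq up.in_cls_self c'(2) by blast
    show False
    proof (cases "c \<in> cls \<omega> a")
      case True
      then have "cls \<omega>1 c = cls \<omega> a \<union> cls \<omega> b" using j c'(1) by (simp add: joins_def)
      then have "c' \<in> cls \<omega> a" using c'_in not_b by blast
      then show False using True neq cls_eqI by blast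
    next
      case False
      then have "cls \<omega>1 c = cls \<omega> c" using j c'(1) not_b by (simp add: joins_def)
      then show False using c'_in neq cls_eqI by blast
    qed
  qed
  then have "\<not> (up.wl c' c \<and> up.wl c c')" using up.wl_antisym up.cls_eq_iff c'(2) by blast
  \<comment> \<open>In the new left-to-right order either of the two may be the right-hand
    one.\<close>
  then have "c \<in> collisions n \<omega>1 \<omega>' \<or> c' \<in> collisions n \<omega>1 \<omega>'"
    using c' unfolding collisions_def mem_Collect_eq by metis
  then obtain e where e: "e \<in> collisions n \<omega>1 \<omega>'" "e \<in> {1..n}" "wl e b"
    using c' W by blast
  then have "pl n \<omega>1 d \<le> pl n \<omega>1 e" using d up.pl_mono by (auto simp: first_collision_def)
  also have "\<dots> < pl n \<omega> b" using joins_pl[OF j] e by blast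
  finally show ?thesis .
qed

lemma first_collision_cover:
  assumes "perm_extension n \<omega> \<omega>'" "first_collision n \<omega> \<omega>' b"
  obtains a \<omega>1 where "covered_by (perm_preorders n) (\<subseteq>) \<omega> \<omega>1" "joins n \<omega> \<omega>1 a b"
    "perm_extension n \<omega> \<omega>1" "perm_extension n \<omega>1 \<omega>'"
proof -
  interpret perm_extension n \<omega> \<omega>' by (fact assms)
  obtain a z where z: "perm_preorder n z" "\<omega> \<subseteq> z" "z \<subseteq> \<omega>'" "joins n \<omega> z a b"
    using ex_join[OF assms(2)] by metis
  then have ext: "perm_extension n \<omega> z" "perm_extension n z \<omega>'"
    using perm_preorder_axioms up.perm_preorder_axioms by (auto simp: perm_extension_iff)
  then show thesis using that perm_extension.joins_covered_by z(4) by blast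
qed

theorem theorem4p3:
  fixes n :: nat
  shows "EL_labeling (perm_preorders n) (\<subseteq>) cover_label"
proof (rule EL_labelingI[where r = "\<lambda>\<omega>. card (blocks \<omega>)"])
  fix \<omega> \<omega>' assume "covered_by (perm_preorders n) (\<subseteq>) \<omega> \<omega>'"
  then show "card (blocks \<omega>) = Suc (card (blocks \<omega>'))"
    using covered_by_joins perm_extension.joins_card_blocks by metis
next
  let ?cov = "covered_by (perm_preorders n) (\<subseteq>)"
  fix \<omega> \<omega>' assume "\<omega> \<in> perm_preorders n" "\<omega>' \<in> perm_preorders n" "\<omega> \<subseteq> \<omega>'" and neq: "\<omega> \<noteq> \<omega>'"
  then have ext: "perm_extension n \<omega> \<omega>'" by (simp add: perm_extension_iff perm_preorders_iff)
  then interpret perm_extension n \<omega> \<omega>' .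
  obtain b where b: "first_collision n \<omega> \<omega>' b" using ex_first_collision[OF neq] .
  obtain a z where z: "?cov \<omega> z" "joins n \<omega> z a b" "perm_extension n \<omega> z" "perm_extension n z \<omega>'"
    using first_collision_cover[OF ext b] .
  have label_z: "cover_label \<omega> z = pl n \<omega> b" using perm_extension.cover_label_joins[OF z(3,2)] .
  \<comment> \<open>Every cover of \<open>z\<close> below \<open>\<omega>'\<close> merges at a
    collision of \<open>z\<close>, and no such collision has placement below that of
    \<open>b\<close>.\<close>
  have 1: "cover_label \<omega> z \<le> cover_label z v" if v: "?cov z v" "v \<subseteq> \<omega>'" for v
  proof -
    obtain c d where cd: "perm_extension n z v" "joins n z v c d" using covered_by_joins[OF v(1)] .
    then have "perm_extension n v \<omega>'" using v(2) z(4) by (simp add: perm_extension_iff)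
    then have "d \<in> collisions n z \<omega>'" using joins_collision cd by blast
    then show ?thesis
      using joins_first_collision_label_le[OF z(3,4,2) b] label_z perm_extension.cover_label_joins[OF cd]
      by simp
  qed
  have 2: "cover_label \<omega> z < cover_label \<omega> w \<and>
      (w \<noteq> \<omega>' \<longrightarrow> (\<exists>v. ?cov w v \<and> v \<subseteq> \<omega>' \<and> cover_label w v < cover_label \<omega> w))"
    if w: "?cov \<omega> w" "w \<subseteq> \<omega>'" "w \<noteq> z" for w
  proof -
    obtain c d where cd: "perm_extension n \<omega> w" "joins n \<omega> w c d" using covered_by_joins[OF w(1)] .
    have ext_w: "perm_extension n w \<omega>'" using w(2) cd(1) ext by (simp add: perm_extension_iff)
    have d: "d \<in> collisions n \<omega> \<omega>'" "d \<in> {1..n}"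
      using joins_collision[OF cd(2,1) ext_w] cd(2) by (auto simp: joins_def)
    have label_w: "cover_label \<omega> w = pl n \<omega> d" using perm_extension.cover_label_joins[OF cd] .
    \<comment> \<open>If \<open>d\<close> were as far left as \<open>b\<close>, it would be a first
      collision too, and uniqueness of the atom would give \<open>w = z\<close>.\<close>
    have "\<not> wl d b"
    proof
      assume "wl d b"
      then have d': "first_collision n \<omega> \<omega>' d" using b d(1) wl_trans by (auto simp: first_collision_def)
      have zs: "z \<subseteq> \<omega>'" using z(4) by (simp add: perm_extension_iff)
      have "w \<subseteq> z" "z \<subseteq> w"
        using joins_first_collision_subset[OF ext cd(1) z(3) w(2) zs cd(2) z(2) d' b]
          joins_first_collision_subset[OF ext z(3) cd(1) zs w(2) z(2) cd(2) b d'] by auto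
      then show False using w(3) by blast
    qed
    then have "pl n \<omega> b < pl n \<omega> d" and not: "\<not> wl d b" using pl_less d(2) by blast+
    \<comment> \<open>The smaller label is attained by merging at the first collision of
      \<open>w\<close>: \<open>b\<close> lies strictly left of \<open>d\<close> and its collision is
      still unresolved in \<open>w\<close>.\<close>
    moreover have "\<exists>v. ?cov w v \<and> v \<subseteq> \<omega>' \<and> cover_label w v < cover_label \<omega> w" if w': "w \<noteq> \<omega>'"
    proof -
      obtain e where e: "first_collision n w \<omega>' e"
        using perm_extension.ex_first_collision[OF ext_w w'] .
      obtain f v where v: "?cov w v" "joins n w v f e" "perm_extension n w v" "perm_extension n v \<omega>'"
        using first_collision_cover[OF ext_w e] .
      have "b \<in> collisions n \<omega> \<omega>'" using b by (simp add: first_collision_def)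
      then have "pl n w e < pl n \<omega> d"
        using joins_later_collision_label_less[OF cd(1) ext_w cd(2) _ not e] by blast
      moreover have "v \<subseteq> \<omega>'" using v(4) by (simp add: perm_extension_iff)
      ultimately show ?thesis
        using v(1) label_w perm_extension.cover_label_joins[OF v(3,2)] by auto
    qed
    ultimately show ?thesis using label_z label_w by simp
  qed
  have "z \<subseteq> \<omega>'" using z(4) by (simp add: perm_extension_iff)
  with z(1) 1 2 show "\<exists>z. ?cov \<omega> z \<and> z \<subseteq> \<omega>' \<and>
      (\<forall>v. ?cov z v \<and> v \<subseteq> \<omega>' \<longrightarrow> cover_label \<omega> z \<le> cover_label z v) \<and>
      (\<forall>w. ?cov \<omega> w \<and> w \<subseteq> \<omega>' \<and> w \<noteq> z \<longrightarrow> cover_label \<omega> z < cover_label \<omega> w \<and>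
        (w \<noteq> \<omega>' \<longrightarrow> (\<exists>v. ?cov w v \<and> v \<subseteq> \<omega>' \<and> cover_label w v < cover_label \<omega> w)))"
    by blast
qed auto

end
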